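(* Let $G=\langle\sigma\rangle$ be a group of order $2$, and let $A$ be a $G$-module which is a finitely generated abelian group. Then $$\sharp \mathrm{H}^1(G,A)=\frac{2^{r_-(A)}\cdot\sharp A^+[2]}{(A:A^++A^-)}=\frac{2^{r_-(A)}\cdot\sharp A^+[2]}{(NA:2A^+)}=2^{r_-(A)-r_+(A)}\cdot(A^+:NA)=2^{r(A)-2r_+(A)}\cdot(A^+:NA),$$ and $$h(G,A)=2^{2r_+(A)-r(A)}.$$ In particular, if $r_+(A)=0$ and $A^+[2]=\{0\}$, then $A=A^++A^-$ and $\sharp\mathrm{H}^1(G,A)=2^{r_-(A)}=2^{r(A)}$.
   Context: $\sharp S$ denotes the cardinality of a set $S$. For an abelian group $B$ (written additively) and a positive integer $m$, $mB=\{mb:b\in B\}$ and $B[m]=\{b\in B: mb=0\}$. For the $G$-module $A$: $A^+=A^G=\{a\in A:\sigma a=a\}$, $A^-=\{a\in A:\sigma a=-a\}$, $NA=(1+\sigma)A=\{a+\sigma a:a\in A\}$, $r(A)=\mathrm{rank}(A)$, $r_+(A)=\mathrm{rank}(A^+)$, $r_-(A)=\mathrm{rank}(A^-)$ (ranks as finitely generated abelian groups). $\widehat{\mathrm{H}}^0(G,A)=A^G/NA$ is the Tate cohomology group in degree $0$, $\mathrm{H}^1(G,A)$ is the usual first cohomology group, and the Herbrand quotient is $h(G,A)=\sharp\widehat{\mathrm{H}}^0(G,A)/\sharp\mathrm{H}^1(G,A)$. *)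

theory Defs
  imports Complex_Main "HOL-Algebra.Algebra" "HOL-Algebra.Bij" "HOL-Algebra.Product_Groups"
begin

text \<open>
  As usual in HOL-Algebra, abelian groups are objects of the locale \<open>comm_group\<close> and hence are
  written multiplicatively: \<open>a \<otimes> b\<close> stands for $a + b$, \<open>inv a\<close> for $-a$, \<open>\<one>\<close> for $0$ and
  \<open>a [^] m\<close> for $ma$. A subgroup \<open>B\<close> of \<open>A\<close> is a subset of the carrier; viewed as a group in its
  own right it is \<open>A\<lparr>carrier := B\<rparr>\<close>.
\<close>

locale group_module = group_hom G "AutoGroup A" \<phi> + comm_group A
  for G :: "('g, 'u) monoid_scheme" and A :: "('a, 'v) monoid_scheme" and \<phi>

definition finitely_generated_group :: "('a, 'v) monoid_scheme \<Rightarrow> bool" where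
  "finitely_generated_group A \<longleftrightarrow> (\<exists>S. finite S \<and> S \<subseteq> carrier A \<and> generate A S = carrier A)"

definition int_independent :: "('a, 'v) monoid_scheme \<Rightarrow> 'a set \<Rightarrow> bool" where
  "int_independent A S \<longleftrightarrow> finite S \<and> S \<subseteq> carrier A \<and>
     (\<forall>c :: 'a \<Rightarrow> int. finprod A (\<lambda>x. x [^]\<^bsub>A\<^esub> c x) S = \<one>\<^bsub>A\<^esub> \<longrightarrow> (\<forall>x\<in>S. c x = 0))"

text \<open>The supremum is taken over a bounded set when \<open>A\<close> is finitely generated; it carries no
  meaning for groups of infinite rank.\<close>

definition group_rank :: "('a, 'v) monoid_scheme \<Rightarrow> nat" where
  "group_rank A = Sup {card S | S. int_independent A S}"

definition subgroup_index :: "('a, 'v) monoid_scheme \<Rightarrow> 'a set \<Rightarrow> 'a set \<Rightarrow> nat" where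
  "subgroup_index A B C = card (rcosets\<^bsub>A\<lparr>carrier := B\<rparr>\<^esub> C)"

definition multiples :: "('a, 'v) monoid_scheme \<Rightarrow> nat \<Rightarrow> 'a set \<Rightarrow> 'a set" where
  "multiples A m B = {b [^]\<^bsub>A\<^esub> m | b. b \<in> B}"

definition torsion :: "('a, 'v) monoid_scheme \<Rightarrow> nat \<Rightarrow> 'a set \<Rightarrow> 'a set" where
  "torsion A m B = {b \<in> B. b [^]\<^bsub>A\<^esub> m = \<one>\<^bsub>A\<^esub>}"

text \<open>The sets $A^+$, $A^-$ and $(1+s)A$ for an endomorphism \<open>s\<close> of \<open>A\<close>.\<close>

definition plus_part :: "('a, 'v) monoid_scheme \<Rightarrow> ('a \<Rightarrow> 'a) \<Rightarrow> 'a set" where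
  "plus_part A s = {a \<in> carrier A. s a = a}"

definition minus_part :: "('a, 'v) monoid_scheme \<Rightarrow> ('a \<Rightarrow> 'a) \<Rightarrow> 'a set" where
  "minus_part A s = {a \<in> carrier A. s a = inv\<^bsub>A\<^esub> a}"

definition norm_part :: "('a, 'v) monoid_scheme \<Rightarrow> ('a \<Rightarrow> 'a) \<Rightarrow> 'a set" where
  "norm_part A s = {a \<otimes>\<^bsub>A\<^esub> s a | a. a \<in> carrier A}"

definition invariants ::
  "('g, 'u) monoid_scheme \<Rightarrow> ('a, 'v) monoid_scheme \<Rightarrow> ('g \<Rightarrow> 'a \<Rightarrow> 'a) \<Rightarrow> 'a set" where
  "invariants G A \<phi> = {a \<in> carrier A. \<forall>g \<in> carrier G. \<phi> g a = a}"

definition norms ::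
  "('g, 'u) monoid_scheme \<Rightarrow> ('a, 'v) monoid_scheme \<Rightarrow> ('g \<Rightarrow> 'a \<Rightarrow> 'a) \<Rightarrow> 'a set" where
  "norms G A \<phi> = {finprod A (\<lambda>g. \<phi> g a) (carrier G) | a. a \<in> carrier A}"

definition tate_H0 ::
  "('g, 'u) monoid_scheme \<Rightarrow> ('a, 'v) monoid_scheme \<Rightarrow> ('g \<Rightarrow> 'a \<Rightarrow> 'a) \<Rightarrow> ('a set) monoid" where
  "tate_H0 G A \<phi> = A\<lparr>carrier := invariants G A \<phi>\<rparr> Mod norms G A \<phi>"

text \<open>$\mathrm{H}^1$ is the group of crossed homomorphisms modulo the principal ones, the former
  being regarded as a subgroup of the group of all functions from \<open>G\<close> to \<open>A\<close>.\<close>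

abbreviation cochains1 :: "('g, 'u) monoid_scheme \<Rightarrow> ('a, 'v) monoid_scheme \<Rightarrow> ('g \<Rightarrow> 'a) monoid"
  where "cochains1 G A \<equiv> product_group (carrier G) (\<lambda>_. A)"

definition cocycles1 ::
  "('g, 'u) monoid_scheme \<Rightarrow> ('a, 'v) monoid_scheme \<Rightarrow> ('g \<Rightarrow> 'a \<Rightarrow> 'a) \<Rightarrow> ('g \<Rightarrow> 'a) set" where
  "cocycles1 G A \<phi> = {f \<in> carrier (cochains1 G A).
     \<forall>g \<in> carrier G. \<forall>h \<in> carrier G. f (g \<otimes>\<^bsub>G\<^esub> h) = f g \<otimes>\<^bsub>A\<^esub> \<phi> g (f h)}"

definition coboundaries1 ::
  "('g, 'u) monoid_scheme \<Rightarrow> ('a, 'v) monoid_scheme \<Rightarrow> ('g \<Rightarrow> 'a \<Rightarrow> 'a) \<Rightarrow> ('g \<Rightarrow> 'a) set" where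
  "coboundaries1 G A \<phi> = {(\<lambda>g \<in> carrier G. \<phi> g a \<otimes>\<^bsub>A\<^esub> inv\<^bsub>A\<^esub> a) | a. a \<in> carrier A}"

definition group_H1 ::
  "('g, 'u) monoid_scheme \<Rightarrow> ('a, 'v) monoid_scheme \<Rightarrow> ('g \<Rightarrow> 'a \<Rightarrow> 'a) \<Rightarrow> (('g \<Rightarrow> 'a) set) monoid"
  where
  "group_H1 G A \<phi> = (cochains1 G A)\<lparr>carrier := cocycles1 G A \<phi>\<rparr> Mod coboundaries1 G A \<phi>"

definition herbrand_quotient ::
  "('g, 'u) monoid_scheme \<Rightarrow> ('a, 'v) monoid_scheme \<Rightarrow> ('g \<Rightarrow> 'a \<Rightarrow> 'a) \<Rightarrow> real" where
  "herbrand_quotient G A \<phi> = real (order (tate_H0 G A \<phi>)) / real (order (group_H1 G A \<phi>))"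

text \<open>For a group of order two the general notions of invariants and norms reduce to those in
  terms of the generator.\<close>

lemma order_two_generator:
  assumes "group G" "order G = 2" "\<sigma> \<in> carrier G" "generate G {\<sigma>} = carrier G"
  shows "carrier G = {\<one>\<^bsub>G\<^esub>, \<sigma>}" "\<sigma> \<noteq> \<one>\<^bsub>G\<^esub>"
proof -
  interpret group G by fact
  show "\<sigma> \<noteq> \<one>\<^bsub>G\<^esub>"
  proof
    assume "\<sigma> = \<one>\<^bsub>G\<^esub>"
    then have "carrier G = {\<one>\<^bsub>G\<^esub>}"
      using assms(4) generate_one by simp
    then show False
      using assms(2) by (simp add: order_def)
  qed
  then have "card {\<one>\<^bsub>G\<^esub>, \<sigma>} = card (carrier G)"
    using assms(2) by (simp add: order_def)
  moreover have "finite (carrier G)"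
    using assms(2) by (simp add: order_def card_ge_0_finite)
  ultimately show "carrier G = {\<one>\<^bsub>G\<^esub>, \<sigma>}"
    using assms(3) by (metis card_subset_eq empty_subsetI insert_subset one_closed)
qed

lemma (in group_module)
  shows action_one: "a \<in> carrier A \<Longrightarrow> \<phi> \<one>\<^bsub>G\<^esub> a = a"
    and action_closed: "g \<in> carrier G \<Longrightarrow> a \<in> carrier A \<Longrightarrow> \<phi> g a \<in> carrier A"
proof -
  show "a \<in> carrier A \<Longrightarrow> \<phi> \<one>\<^bsub>G\<^esub> a = a"
    using hom_one by (simp add: AutoGroup_def BijGroup_def)
  show "g \<in> carrier G \<Longrightarrow> a \<in> carrier A \<Longrightarrow> \<phi> g a \<in> carrier A"
    using hom_closed[of g] by (auto simp: AutoGroup_def auto_def hom_def)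
qed

lemma (in group_module)
  assumes "order G = 2" "\<sigma> \<in> carrier G" "generate G {\<sigma>} = carrier G"
  shows invariants_order_two: "invariants G A \<phi> = plus_part A (\<phi> \<sigma>)"
    and norms_order_two: "norms G A \<phi> = norm_part A (\<phi> \<sigma>)"
proof -
  note G = order_two_generator[OF G.is_group assms]
  show "invariants G A \<phi> = plus_part A (\<phi> \<sigma>)"
    by (auto simp: invariants_def plus_part_def G(1) action_one simp del: hom_one)
  have "finprod A (\<lambda>g. \<phi> g a) (carrier G) = a \<otimes>\<^bsub>A\<^esub> \<phi> \<sigma> a" if "a \<in> carrier A" for a
    using that G(2) action_closed[OF assms(2) that] by (simp add: G(1) action_one del: hom_one)
  then show "norms G A \<phi> = norm_part A (\<phi> \<sigma>)"
    unfolding norms_def norm_part_def by metis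
qed

end

theory Submission
  imports Defs
begin

text \<open>
  In all comments abelian groups are written additively. Put \<open>D = (\<sigma> - 1)A\<close>. A crossed
  homomorphism is determined by its value at \<open>\<sigma>\<close>, which can be any element of \<open>A\<^sup>-\<close>, and the
  principal ones correspond to the elements of \<open>D\<close>; so \<open>H\<^sup>1\<close> is \<open>A\<^sup>-/D\<close>
  (lemma \<open>order_group_H1_order_two\<close>).

  The map \<open>1 + \<sigma>\<close> takes \<open>A\<close> onto \<open>NA\<close> with kernel \<open>A\<^sup>-\<close>, and it takes \<open>A\<^sup>+ + A\<^sup>-\<close> onto
  \<open>2A\<^sup>+\<close>. Hence \<open>(A : A\<^sup>+ + A\<^sup>-) = (NA : 2A\<^sup>+)\<close>. In the same way \<open>\<sigma> - 1\<close> has kernel \<open>A\<^sup>+\<close> and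
  yields \<open>(A : A\<^sup>+ + A\<^sup>-) = (D : 2A\<^sup>-)\<close>. With this common index \<open>i\<close>, the towers
  \<open>2A\<^sup>+ \<subseteq> NA \<subseteq> A\<^sup>+\<close> and \<open>2A\<^sup>- \<subseteq> D \<subseteq> A\<^sup>-\<close> give \<open>(A\<^sup>+ : 2A\<^sup>+) = (A\<^sup>+ : NA) i\<close> and
  \<open>(A\<^sup>- : 2A\<^sup>-) = (A\<^sup>- : D) i\<close>. Since \<open>A\<^sup>+[2] = A\<^sup>-[2]\<close>, everything then follows from two facts
  about ranks: the rank of \<open>A\<close> is the sum of the ranks of \<open>A\<^sup>+\<close> and \<open>A\<^sup>-\<close>, and
  \<open>(B : 2B) = 2^rank(B) \<sharp>B[2]\<close> for every subgroup \<open>B\<close> of a finitely generated abelian group.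

  For the latter, let \<open>F\<close> be the span of an independent set \<open>S\<close>, of finite index in \<open>B\<close>. Comparing
  the two chains from \<open>2F\<close> to \<open>B\<close>, through \<open>F\<close> and through \<open>2B\<close>, gives
  \<open>(B : 2B) = (F : 2F) \<sharp>B[2]\<close>, and \<open>(F : 2F)\<close> is \<open>2\<close> to the power \<open>card S\<close>
  (lemma \<open>subgroup_index_multiples\<close>). It remains to find such an \<open>S\<close> whose size is the rank.
  An independent set in \<open>A\<close> can be enlarged by generators of \<open>A\<close> until its span has finite index.
  The formula for \<open>(A : 2A)\<close> then bounds the sizes of independent sets, so that in every subgroup
  \<open>B\<close> there is one of maximal size, \<open>S\<close>. Enlarging it to a set \<open>T\<close> whose span has finite index in
  \<open>A\<close> adds nothing inside \<open>B\<close>: the span of \<open>T\<close> meets \<open>B\<close> in the span of \<open>S\<close> only, which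
  therefore has finite index in \<open>B\<close> (lemma \<open>finite_index_int_span\<close>).
\<close>

section \<open>Indices of subgroups\<close>

lemma subgroup_index_eq_card_cosets: "subgroup_index A B C = card ((#>\<^bsub>A\<^esub>) C ` B)"
  by (simp add: subgroup_index_def RCOSETS_def r_coset_def UNION_singleton_eq_range)

lemma (in group) r_coset_eq_iff:
  assumes "subgroup H G" "a \<in> carrier G" "b \<in> carrier G"
  shows "H #> a = H #> b \<longleftrightarrow> a \<otimes> inv b \<in> H"
  using assms
  by (metis is_group repr_independence subgroup.rcos_module_imp subgroup.rcos_module_rev rcos_self)

text \<open>
  Fixing a representative of each coset of \<open>B\<close> in \<open>D\<close> identifies the cosets of \<open>C\<close> in \<open>D\<close> with
  pairs of a coset of \<open>B\<close> in \<open>D\<close> and a coset of \<open>C\<close> in \<open>B\<close>. Because infinite sets have cardinality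
  \<open>0\<close>, this bijection gives the equation also for infinite indices. In particular, if one side is
  nonzero, all three indices are finite.
\<close>

lemma (in group) subgroup_index_tower:
  assumes C: "subgroup C G" and B: "subgroup B G" and D: "subgroup D G"
    and "C \<subseteq> B" "B \<subseteq> D"
  shows "subgroup_index G D C = subgroup_index G D B * subgroup_index G B C"
proof -
  note sub = subgroup.subset[OF B] subgroup.subset[OF C] subgroup.subset[OF D]
  have cancel: "inv x \<otimes> (x \<otimes> y) = y" "x \<otimes> (inv x \<otimes> y) = y"
    if "x \<in> carrier G" "y \<in> carrier G" for x y
    using that by (simp_all add: m_assoc[symmetric])
  define rep where "rep M = (SOME d. d \<in> D \<and> B #> d = M)" for M
  have "rep (B #> d) \<in> D \<and> B #> rep (B #> d) = B #> d" if "d \<in> D" for d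
    unfolding rep_def by (rule someI[of _ d]) (use that in simp)
  then have rep: "rep (B #> d) \<in> D" "B #> rep (B #> d) = B #> d" if "d \<in> D" for d
    using that by blast+
  \<comment> \<open>the coset \<open>C #> b\<close> is moved by the representative \<open>rep M\<close> into the coset \<open>M\<close> of \<open>B\<close>\<close>
  define \<theta> where "\<theta> = (\<lambda>(M, K). K #> rep M)"
  have \<theta>: "\<theta> (B #> d, C #> b) = C #> (b \<otimes> rep (B #> d))" if "d \<in> D" "b \<in> B" for b d
  proof -
    have "b \<in> carrier G" "rep (B #> d) \<in> carrier G"
      using rep(1)[OF that(1)] that sub by blast+
    then show ?thesis
      using sub by (simp add: \<theta>_def coset_mult_assoc)
  qed
  have "bij_betw \<theta> ((#>) B ` D \<times> (#>) C ` B) ((#>) C ` D)"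
  proof (intro bij_betw_imageI inj_onI)
    fix p q
    assume "p \<in> (#>) B ` D \<times> (#>) C ` B" "q \<in> (#>) B ` D \<times> (#>) C ` B" and eq: "\<theta> p = \<theta> q"
    then obtain d b d' b' where p: "p = (B #> d, C #> b)" "d \<in> D" "b \<in> B"
      and q: "q = (B #> d', C #> b')" "d' \<in> D" "b' \<in> B"
      by auto
    let ?r = "rep (B #> d)" and ?r' = "rep (B #> d')"
    have r: "?r \<in> carrier G" "?r' \<in> carrier G" and b: "b \<in> carrier G" "b' \<in> carrier G"
      using rep(1) p q sub by blast+
    have "C #> (b \<otimes> ?r) = C #> (b' \<otimes> ?r')"
      using eq p q by (simp add: \<theta>)
    then have c: "(b \<otimes> ?r) \<otimes> inv (b' \<otimes> ?r') \<in> C"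
      using r b by (simp add: r_coset_eq_iff[OF C])
    then have cB: "(b \<otimes> ?r) \<otimes> inv (b' \<otimes> ?r') \<in> B"
      using \<open>C \<subseteq> B\<close> by (rule rev_subsetD)
    \<comment> \<open>cancelling \<open>b\<close> and \<open>b'\<close>, which lie in \<open>B\<close>, compares the representatives\<close>
    have "inv b \<otimes> ((b \<otimes> ?r) \<otimes> inv (b' \<otimes> ?r')) \<otimes> b' \<in> B"
      by (rule subgroup.m_closed[OF B subgroup.m_closed[OF B subgroup.m_inv_closed[OF B p(3)] cB] q(3)])
    also have "inv b \<otimes> ((b \<otimes> ?r) \<otimes> inv (b' \<otimes> ?r')) \<otimes> b' = ?r \<otimes> inv ?r'"
      using r b by (simp add: m_assoc inv_mult_group cancel)
    finally have "B #> ?r = B #> ?r'"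
      using r by (simp add: r_coset_eq_iff[OF B])
    then have 1: "B #> d = B #> d'"
      using rep(2)[OF p(2)] rep(2)[OF q(2)] by simp
    have "(b \<otimes> ?r) \<otimes> inv (b' \<otimes> ?r) = b \<otimes> inv b'"
      using r b by (simp add: m_assoc inv_mult_group cancel)
    then have "C #> b = C #> b'"
      using c 1 b by (simp add: r_coset_eq_iff[OF C])
    with 1 show "p = q"
      using p q by simp
  next
    show "\<theta> ` ((#>) B ` D \<times> (#>) C ` B) = (#>) C ` D"
    proof (intro equalityI subsetI)
      fix Z assume "Z \<in> \<theta> ` ((#>) B ` D \<times> (#>) C ` B)"
      then obtain d b where "Z = \<theta> (B #> d, C #> b)" "d \<in> D" "b \<in> B"
        by auto
      moreover from this have "b \<otimes> rep (B #> d) \<in> D"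
        using rep(1) \<open>B \<subseteq> D\<close> by (intro subgroup.m_closed[OF D]) auto
      ultimately show "Z \<in> (#>) C ` D"
        by (simp add: \<theta>)
    next
      fix Z assume "Z \<in> (#>) C ` D"
      then obtain d where d: "d \<in> D" "Z = C #> d"
        by auto
      let ?r = "rep (B #> d)"
      have r: "?r \<in> carrier G" "d \<in> carrier G"
        using rep(1) d sub by blast+
      have "B #> d = B #> ?r" using rep(2)[OF d(1)] by simp
      then have "d \<otimes> inv ?r \<in> B"
        using r by (simp add: r_coset_eq_iff[OF B])
      moreover have "d \<otimes> inv ?r \<otimes> ?r = d"
        using r by (simp add: m_assoc)
      ultimately have "Z = \<theta> (B #> d, C #> (d \<otimes> inv ?r))"
        using d by (simp add: \<theta>)
      with d \<open>d \<otimes> inv ?r \<in> B\<close> show "Z \<in> \<theta> ` ((#>) B ` D \<times> (#>) C ` B)"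
        by blast
    qed
  qed
  from bij_betw_same_card[OF this] show ?thesis
    by (simp add: subgroup_index_eq_card_cosets card_cartesian_product)
qed

text \<open>
  The image of a coset of \<open>C\<close> is a coset of \<open>h ` C\<close>, and because \<open>C\<close> contains the kernel of \<open>h\<close>
  on \<open>B\<close>, distinct cosets of \<open>C\<close> in \<open>B\<close> have distinct images.
\<close>

lemma (in group_hom) subgroup_index_image:
  assumes C: "subgroup C G" and B: "subgroup B G" and "C \<subseteq> B"
    and ker: "\<And>b. b \<in> B \<Longrightarrow> h b = \<one>\<^bsub>H\<^esub> \<Longrightarrow> b \<in> C"
  shows "subgroup_index H (h ` B) (h ` C) = subgroup_index G B C"
proof -
  note sub = subgroup.subset[OF B] subgroup.subset[OF C]
  have hC: "subgroup (h ` C) H"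
    by (rule subgroup_img_is_subgroup[OF C])
  have iff: "h ` C #>\<^bsub>H\<^esub> h a = h ` C #>\<^bsub>H\<^esub> h b \<longleftrightarrow> C #> a = C #> b" if "a \<in> B" "b \<in> B" for a b
  proof -
    have ab: "a \<in> carrier G" "b \<in> carrier G" using that sub by auto
    have "a \<otimes> inv b \<in> C" if "h (a \<otimes> inv b) = h c" "c \<in> C" for c
    proof -
      have c: "c \<in> carrier G" "c \<in> B" using that assms sub by auto
      have "h (a \<otimes> inv b \<otimes> inv c) = \<one>\<^bsub>H\<^esub>"
        using that ab c by simp
      then have "a \<otimes> inv b \<otimes> inv c \<in> C"
        using \<open>a \<in> B\<close> \<open>b \<in> B\<close> c B
        by (intro ker) (auto intro!: subgroup.m_closed subgroup.m_inv_closed)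
      then have "a \<otimes> inv b \<otimes> inv c \<otimes> c \<in> C"
        using that C by (auto intro: subgroup.m_closed)
      then show ?thesis using ab c by (simp add: G.m_assoc)
    qed
    then have "h (a \<otimes> inv b) \<in> h ` C \<longleftrightarrow> a \<otimes> inv b \<in> C"
      by auto
    then show ?thesis
      using ab by (simp add: G.r_coset_eq_iff[OF C] H.r_coset_eq_iff[OF hC])
  qed
  have img: "h ` (C #> b) = h ` C #>\<^bsub>H\<^esub> h b" if "b \<in> B" for b
  proof -
    have "h (c \<otimes> b) = h c \<otimes>\<^bsub>H\<^esub> h b" if "c \<in> C" for c
      using that \<open>b \<in> B\<close> sub by (intro hom_mult) auto
    then show ?thesis by (simp add: r_coset_def image_UN)
  qed
  have "inj_on ((`) h) ((#>) C ` B)"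
    using iff by (auto simp: inj_on_def img)
  moreover have "(#>\<^bsub>H\<^esub>) (h ` C) ` h ` B = (`) h ` (#>) C ` B"
    by (simp add: image_image img)
  ultimately show ?thesis
    by (simp add: subgroup_index_eq_card_cosets card_image)
qed

lemma (in group)
  assumes "subgroup H G" "subgroup K G"
  shows set_mult_superset_left: "H \<subseteq> H <#> K" and set_mult_superset_right: "K \<subseteq> H <#> K"
proof -
  note one = subgroup.one_closed[OF assms(1)] subgroup.one_closed[OF assms(2)]
  have "x \<in> H <#> K" if "x \<in> H" for x
  proof -
    have "x = x \<otimes> \<one>" using that subgroup.mem_carrier[OF assms(1)] by simp
    then show ?thesis using that one unfolding set_mult_def by blast
  qed
  moreover have "x \<in> H <#> K" if "x \<in> K" for x
  proof -
    have "x = \<one> \<otimes> x" using that subgroup.mem_carrier[OF assms(2)] by simp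
    then show ?thesis using that one unfolding set_mult_def by blast
  qed
  ultimately show "H \<subseteq> H <#> K" "K \<subseteq> H <#> K" by blast+
qed

text \<open>
  Each coset of \<open>F\<close> in \<open>F <#> T\<close> contains exactly one element of \<open>T\<close>.
\<close>

lemma (in group) subgroup_index_prod_eq_card:
  assumes F: "subgroup F G" and T: "subgroup T G" and "F \<inter> T = {\<one>}"
  shows "subgroup_index G (F <#> T) F = card T"
proof -
  note sub = subgroup.subset[OF F] subgroup.subset[OF T]
  have "inj_on ((#>) F) T"
  proof (rule inj_onI)
    fix s t assume st: "s \<in> T" "t \<in> T" "F #> s = F #> t"
    then have "s \<otimes> inv t \<in> F"
      using sub by (subst (asm) r_coset_eq_iff[OF F]) auto
    moreover have "s \<otimes> inv t \<in> T"
      using st T by (auto intro!: subgroup.m_closed subgroup.m_inv_closed)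
    ultimately have "s \<otimes> inv t = \<one>" using assms by auto
    then show "s = t" using st sub by (metis inv_equality inv_inv subsetD inv_closed)
  qed
  moreover have "(#>) F ` (F <#> T) = (#>) F ` T"
  proof -
    have eq: "F #> (f \<otimes> t) = F #> t" if "f \<in> F" "t \<in> T" for f t
      using that sub
      by (subst r_coset_eq_iff[OF F]) (auto simp: m_assoc subset_iff)
    show ?thesis
    proof (intro equalityI subsetI)
      show "M \<in> (#>) F ` T" if "M \<in> (#>) F ` (F <#> T)" for M
        using that eq by (auto simp: set_mult_def)
      show "M \<in> (#>) F ` (F <#> T)" if "M \<in> (#>) F ` T" for M
        using that set_mult_superset_right[OF F T] by blast
    qed
  qed
  ultimately show ?thesis
    by (simp add: subgroup_index_eq_card_cosets card_image)
qed

section \<open>Integer combinations\<close>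

definition int_comb :: "('a, 'v) monoid_scheme \<Rightarrow> ('a \<Rightarrow> int) \<Rightarrow> 'a set \<Rightarrow> 'a" where
  "int_comb A c S = finprod A (\<lambda>x. x [^]\<^bsub>A\<^esub> c x) S"

definition int_span :: "('a, 'v) monoid_scheme \<Rightarrow> 'a set \<Rightarrow> 'a set" where
  "int_span A S = range (\<lambda>c. int_comb A c S)"

text \<open>
  The elements that become torsion modulo \<open>H\<close>. The isolator plays the part of the rational span of
  \<open>H\<close>: a set generates the group up to torsion if the isolator of its span is the whole group.
\<close>

definition isolator :: "('a, 'v) monoid_scheme \<Rightarrow> 'a set \<Rightarrow> 'a set" where
  "isolator A H = {a \<in> carrier A. \<exists>n::int. n \<noteq> 0 \<and> a [^]\<^bsub>A\<^esub> n \<in> H}"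

context comm_group
begin

lemma int_comb_closed [simp]: "S \<subseteq> carrier G \<Longrightarrow> int_comb G c S \<in> carrier G"
  by (auto simp: int_comb_def intro!: finprod_closed)

lemma int_comb_cong:
  "S \<subseteq> carrier G \<Longrightarrow> (\<And>x. x \<in> S \<Longrightarrow> c x = d x) \<Longrightarrow> int_comb G c S = int_comb G d S"
  unfolding int_comb_def by (rule finprod_cong') auto

lemma int_comb_zero: "(\<And>x. x \<in> S \<Longrightarrow> c x = 0) \<Longrightarrow> int_comb G c S = \<one>"
  unfolding int_comb_def by (rule finprod_one_eqI) auto

lemma int_comb_add:
  assumes "S \<subseteq> carrier G"
  shows "int_comb G (\<lambda>x. c x + d x) S = int_comb G c S \<otimes> int_comb G d S"
proof -
  have "int_comb G (\<lambda>x. c x + d x) S = finprod G (\<lambda>x. x [^] c x \<otimes> x [^] d x) S"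
    unfolding int_comb_def using assms by (intro finprod_cong') (auto simp: int_pow_mult)
  also have "\<dots> = int_comb G c S \<otimes> int_comb G d S"
    unfolding int_comb_def using assms by (intro finprod_multf) auto
  finally show ?thesis .
qed

lemma int_comb_insert:
  assumes "insert x S \<subseteq> carrier G" "finite S" "x \<notin> S"
  shows "int_comb G c (insert x S) = x [^] c x \<otimes> int_comb G c S"
  unfolding int_comb_def using assms by (intro finprod_insert) auto

lemma int_comb_Un:
  assumes "S \<union> T \<subseteq> carrier G" "finite S" "finite T" "S \<inter> T = {}"
  shows "int_comb G c (S \<union> T) = int_comb G c S \<otimes> int_comb G c T"
  unfolding int_comb_def using assms by (intro finprod_Un_disjoint) auto

lemma int_comb_pow:
  assumes "S \<subseteq> carrier G"
  shows "int_comb G c S [^] (n::int) = int_comb G (\<lambda>x. c x * n) S"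
  using assms
proof (induction S rule: infinite_finite_induct)
  case (insert x S)
  then show ?case
    by (simp add: int_comb_insert int_pow_distrib int_pow_pow)
qed (simp_all add: int_comb_def)

lemma int_comb_diff:
  assumes "S \<subseteq> carrier G"
  shows "int_comb G (\<lambda>x. c x - d x) S = int_comb G c S \<otimes> inv (int_comb G d S)"
proof -
  have "inv (int_comb G d S) = int_comb G (\<lambda>x. - d x) S"
    using int_comb_pow[OF assms, of d "-1"] assms by (simp add: int_pow_neg)
  then show ?thesis
    using int_comb_add[OF assms, of c "\<lambda>x. - d x"] by simp
qed

lemma int_comb_mem:
  assumes "subgroup H G" "S \<subseteq> H"
  shows "int_comb G c S \<in> H"
  using assms(2)
proof (induction S rule: infinite_finite_induct)
  case (insert x S)
  then show ?case
    using subgroup.subset[OF assms(1)] assms(1)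
    by (subst int_comb_insert)
       (auto intro!: subgroup.m_closed subgroup_int_pow_closed)
qed (use assms subgroup.one_closed in \<open>auto simp: int_comb_def\<close>)

lemma int_span_subset: "subgroup H G \<Longrightarrow> S \<subseteq> H \<Longrightarrow> int_span G S \<subseteq> H"
  by (auto simp: int_span_def int_comb_mem)

lemma subgroup_int_span:
  assumes "S \<subseteq> carrier G"
  shows "subgroup (int_span G S) G"
proof (rule subgroupI)
  show "int_span G S \<subseteq> carrier G" "int_span G S \<noteq> {}"
    using assms by (auto simp: int_span_def)
  show "inv a \<in> int_span G S" if "a \<in> int_span G S" for a
    using that int_comb_diff[OF assms, of "\<lambda>_. 0"] assms
    by (auto simp: int_span_def int_comb_zero) (metis rangeI)
  show "a \<otimes> b \<in> int_span G S" if "a \<in> int_span G S" "b \<in> int_span G S" for a b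
    using that int_comb_add[OF assms, symmetric] by (auto simp: int_span_def)
qed

lemma int_span_superset:
  assumes "finite S" "S \<subseteq> carrier G"
  shows "S \<subseteq> int_span G S"
proof
  fix x assume x: "x \<in> S"
  have "int_comb G (\<lambda>y. if y = x then 1 else 0) (insert x (S - {x})) = x"
    using x assms int_comb_zero[of "S - {x}" "\<lambda>y. if y = x then 1 else 0"]
    by (subst int_comb_insert) auto
  then show "x \<in> int_span G S"
    using x by (auto simp: int_span_def insert_absorb intro!: range_eqI[OF sym])
qed

lemma int_span_mono:
  assumes "S \<subseteq> T" "finite T" "T \<subseteq> carrier G"
  shows "int_span G S \<subseteq> int_span G T"
  using assms int_span_superset by (intro int_span_subset subgroup_int_span) auto

lemma generate_subset_int_span:
  "finite S \<Longrightarrow> S \<subseteq> carrier G \<Longrightarrow> generate G S \<subseteq> int_span G S"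
  by (simp add: generate_subgroup_incl int_span_superset subgroup_int_span)

lemma subgroup_isolator:
  assumes H: "subgroup H G"
  shows "subgroup (isolator G H) G"
proof (rule subgroupI)
  show "isolator G H \<subseteq> carrier G" "isolator G H \<noteq> {}"
    using subgroup.one_closed[OF H] by (auto simp: isolator_def intro!: exI[of _ \<one>] exI[of _ "1::int"])
  show "inv a \<in> isolator G H" if "a \<in> isolator G H" for a
    using that subgroup.m_inv_closed[OF H] by (auto simp: isolator_def int_pow_inv)
  show "a \<otimes> b \<in> isolator G H" if ab: "a \<in> isolator G H" "b \<in> isolator G H" for a b
  proof -
    obtain m n :: int where mn: "m \<noteq> 0" "n \<noteq> 0" "a [^] m \<in> H" "b [^] n \<in> H"
      and ab: "a \<in> carrier G" "b \<in> carrier G"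
      using ab by (auto simp: isolator_def)
    have "(a \<otimes> b) [^] (m * n) = (a [^] m) [^] n \<otimes> (b [^] n) [^] m"
      using ab by (simp add: int_pow_distrib int_pow_pow mult.commute)
    also have "\<dots> \<in> H"
      using mn H by (auto intro!: subgroup.m_closed subgroup_int_pow_closed)
    finally show ?thesis
      using mn ab by (auto simp: isolator_def intro!: exI[of _ "m * n"])
  qed
qed

lemma isolator_superset: "subgroup H G \<Longrightarrow> H \<subseteq> isolator G H"
  using subgroup.subset by (fastforce simp: isolator_def intro: exI[of _ "1::int"])

lemma int_comb_carrier_update:
  assumes B: "subgroup B G" and "S \<subseteq> B"
  shows "int_comb (G\<lparr>carrier := B\<rparr>) c S = int_comb G c S"
proof -
  interpret B: comm_group "G\<lparr>carrier := B\<rparr>"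
    using subgroup_imp_group[OF B] subgroup.subset[OF B]
    by (intro group.group_comm_groupI) (auto intro: m_comm)
  have sub: "B \<subseteq> carrier G" by (rule subgroup.subset[OF B])
  show ?thesis using assms(2)
  proof (induction S rule: infinite_finite_induct)
    case (insert x S)
    moreover from insert have "insert x S \<subseteq> carrier G"
      using sub by auto
    ultimately show ?case
      by (simp add: B.int_comb_insert int_comb_insert int_pow_consistent[OF B, symmetric])
  qed (simp_all add: int_comb_def)
qed

lemma int_independent_carrier_update:
  assumes B: "subgroup B G"
  shows "int_independent (G\<lparr>carrier := B\<rparr>) S \<longleftrightarrow> int_independent G S \<and> S \<subseteq> B"
  using int_comb_carrier_update[OF B] subgroup.subset[OF B]
  by (auto simp: int_independent_def int_comb_def[symmetric])

lemma int_independent_imp: "int_independent G S \<Longrightarrow> finite S \<and> S \<subseteq> carrier G"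
  by (simp add: int_independent_def)

lemma int_independent_zero:
  "int_independent G S \<Longrightarrow> int_comb G c S = \<one> \<Longrightarrow> x \<in> S \<Longrightarrow> c x = 0"
  by (auto simp: int_independent_def int_comb_def)


lemma int_comb_restrict:
  assumes "S \<subseteq> T" "finite T" "T \<subseteq> carrier G"
  shows "int_comb G (\<lambda>x. if x \<in> S then c x else 0) T = int_comb G c S"
proof -
  let ?d = "\<lambda>x. if x \<in> S then c x else 0"
  have "int_comb G ?d (S \<union> (T - S)) = int_comb G ?d S \<otimes> int_comb G ?d (T - S)"
    using assms by (intro int_comb_Un) (auto intro: finite_subset)
  moreover have "int_comb G ?d (T - S) = \<one>"
    by (rule int_comb_zero) auto
  moreover have "int_comb G ?d S = int_comb G c S"
    using assms by (intro int_comb_cong) auto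
  moreover have "S \<union> (T - S) = T" "S \<subseteq> carrier G"
    using assms by auto
  ultimately show ?thesis by simp
qed

lemma int_independent_unique:
  assumes "int_independent G S" "int_comb G c S = int_comb G d S" "x \<in> S"
  shows "c x = d x"
proof -
  have "int_comb G (\<lambda>x. c x - d x) S = \<one>"
    using assms int_independent_imp[OF assms(1)] by (simp add: int_comb_diff)
  then show ?thesis
    using int_independent_zero[OF assms(1), of "\<lambda>x. c x - d x"] assms(3) by simp
qed

text \<open>
  In a dependency the new element must occur with a nonzero exponent, which puts a multiple
  of it into the span of \<open>T\<close>.
\<close>

lemma int_independent_insert:
  assumes T: "int_independent G T" and x: "x \<in> carrier G" "x \<notin> isolator G (int_span G T)"
  shows "int_independent G (insert x T)"
proof -
  have fin: "finite T" "T \<subseteq> carrier G"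
    using int_independent_imp[OF T] by auto
  have "x \<notin> T"
    using x(2) int_span_superset[OF fin] isolator_superset[OF subgroup_int_span[OF fin(2)]] by auto
  have "c y = 0" if c: "int_comb G c (insert x T) = \<one>" and y: "y \<in> insert x T" for c y
  proof -
    have eq: "x [^] c x \<otimes> int_comb G c T = \<one>"
      using c fin x \<open>x \<notin> T\<close> by (simp add: int_comb_insert)
    have "inv (int_comb G c T) = x [^] c x"
      using eq x fin by (intro inv_equality) auto
    then have "int_comb G (\<lambda>y. 0 - c y) T = x [^] c x"
      using int_comb_diff[OF fin(2), of "\<lambda>_. 0" c] x by (simp add: int_comb_zero)
    then have "x [^] c x \<in> int_span G T"
      by (auto simp: int_span_def intro: range_eqI[OF sym])
    then have "c x = 0"
      using x by (auto simp: isolator_def)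
    moreover from this have "int_comb G c T = \<one>"
      using eq fin by simp
    ultimately show ?thesis
      using y int_independent_zero[OF T] by auto
  qed
  then show ?thesis
    using fin x by (simp add: int_independent_def int_comb_def)
qed

section \<open>Doubling\<close>

lemma group_hom_square: "group_hom G G (\<lambda>b. b [^] (2::nat))"
  by (intro group_hom.intro group_hom_axioms.intro is_group)
     (auto simp: hom_def nat_pow_distrib)

lemma multiples_eq_image: "multiples G m B = (\<lambda>b. b [^] m) ` B"
  by (auto simp: multiples_def)

lemma subgroup_multiples:
  assumes "subgroup B G" shows "subgroup (multiples G 2 B) G"
  unfolding multiples_eq_image
  by (rule group_hom.subgroup_img_is_subgroup[OF group_hom_square assms])

lemma multiples_subset: "subgroup B G \<Longrightarrow> multiples G 2 B \<subseteq> B"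
  by (auto simp: multiples_def numeral_2_eq_2 subgroup.m_closed subgroup.one_closed)

lemma subgroup_torsion:
  assumes "subgroup B G" shows "subgroup (torsion G 2 B) G"
proof -
  have "torsion G 2 B = B \<inter> kernel G G (\<lambda>b. b [^] (2::nat))"
    using subgroup.subset[OF assms] by (auto simp: torsion_def kernel_def)
  then show ?thesis
    using subgroups_Inter_pair[OF assms group_hom.subgroup_kernel[OF group_hom_square]] by simp
qed

lemma multiples_int_span:
  assumes "S \<subseteq> carrier G"
  shows "multiples G 2 (int_span G S) = range (\<lambda>c. int_comb G (\<lambda>x. c x * 2) S)"
proof -
  have "int_comb G c S [^] (2::nat) = int_comb G (\<lambda>x. c x * 2) S" for c
    using int_comb_pow[OF assms, of c 2] int_pow_int[of G "int_comb G c S" 2] by simp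
  then show ?thesis
    by (simp add: multiples_eq_image int_span_def image_image)
qed

text \<open>
  Modulo twice the span only the parities of the coefficients matter, so the cosets correspond to the
  subsets of \<open>S\<close>.
\<close>

lemma subgroup_index_multiples_int_span:
  assumes S: "int_independent G S"
  shows "subgroup_index G (int_span G S) (multiples G 2 (int_span G S)) = 2 ^ card S"
proof -
  have fin: "finite S" "S \<subseteq> carrier G"
    using int_independent_imp[OF S] by auto
  let ?F2 = "multiples G 2 (int_span G S)"
  define \<chi> where "\<chi> U x = (if x \<in> U then 1 else 0 :: int)" for U and x :: 'a
  have F2: "subgroup ?F2 G"
    by (simp add: fin subgroup_int_span subgroup_multiples)
  have eq: "?F2 #> int_comb G c S = ?F2 #> int_comb G d S
      \<longleftrightarrow> (\<exists>e. int_comb G (\<lambda>x. c x - d x) S = int_comb G (\<lambda>x. e x * 2) S)" for c d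
  proof -
    have "?F2 #> int_comb G c S = ?F2 #> int_comb G d S
        \<longleftrightarrow> int_comb G (\<lambda>x. c x - d x) S \<in> ?F2"
      using fin by (simp add: r_coset_eq_iff[OF F2] int_comb_diff)
    then show ?thesis
      using fin by (simp add: multiples_int_span image_iff)
  qed
  have "bij_betw (\<lambda>U. ?F2 #> int_comb G (\<chi> U) S) (Pow S) ((#>) ?F2 ` int_span G S)"
  proof (intro bij_betw_imageI inj_onI)
    fix U V assume UV: "U \<in> Pow S" "V \<in> Pow S"
      and "?F2 #> int_comb G (\<chi> U) S = ?F2 #> int_comb G (\<chi> V) S"
    then obtain e where e: "int_comb G (\<lambda>x. \<chi> U x - \<chi> V x) S = int_comb G (\<lambda>x. e x * 2) S"
      by (auto simp: eq)
    have "x \<in> U \<longleftrightarrow> x \<in> V" if "x \<in> S" for x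
    proof -
      have "even (\<chi> U x - \<chi> V x)"
        using int_independent_unique[OF S e that] by simp
      then show ?thesis by (auto simp: \<chi>_def split: if_splits)
    qed
    then show "U = V" using UV by auto
  next
    have "?F2 #> int_comb G c S \<in> (\<lambda>U. ?F2 #> int_comb G (\<chi> U) S) ` Pow S" for c
    proof -
      let ?U = "{x \<in> S. odd (c x)}"
      have "odd a \<Longrightarrow> a - 1 = a div 2 * 2" for a :: int by presburger
      then have "int_comb G (\<lambda>x. c x - \<chi> ?U x) S = int_comb G (\<lambda>x. (c x div 2) * 2) S"
        using fin by (intro int_comb_cong) (auto simp: \<chi>_def)
      then have "?F2 #> int_comb G c S = ?F2 #> int_comb G (\<chi> ?U) S"
        unfolding eq by (rule exI[of _ "\<lambda>x. c x div 2"])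
      then show ?thesis by (intro image_eqI[of _ _ ?U]) auto
    qed
    then show "(\<lambda>U. ?F2 #> int_comb G (\<chi> U) S) ` Pow S = (#>) ?F2 ` int_span G S"
      by (auto simp: int_span_def)
  qed
  from bij_betw_same_card[OF this] show ?thesis
    using fin by (simp add: subgroup_index_eq_card_cosets card_Pow)
qed

text \<open>
  Write \<open>F\<close> for the span of \<open>S\<close> and \<open>T\<close> for the 2-torsion of \<open>B\<close>. Doubling maps \<open>B\<close> onto
  \<open>2B\<close> and \<open>F + T\<close> onto \<open>2F\<close>, with kernel \<open>T\<close>, so that \<open>(2B : 2F) = (B : F + T)\<close>.
  On the other hand \<open>F\<close> is torsion-free, so
  \<open>(B : F) = (B : F + T) \<sharp>T\<close>. The two ways of computing \<open>(B : 2F)\<close> give the formula after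
  cancelling \<open>(B : F + T)\<close>. Finiteness of the torsion comes with it, because \<open>\<sharp>T\<close> is a
  factor of the nonzero number \<open>(B : F)\<close>.
\<close>

lemma subgroup_index_multiples:
  assumes B: "subgroup B G" and S: "int_independent G S" "S \<subseteq> B"
    and fin: "subgroup_index G B (int_span G S) \<noteq> 0"
  shows "subgroup_index G B (multiples G 2 B) = 2 ^ card S * card (torsion G 2 B)"
    and "card (torsion G 2 B) \<noteq> 0"
proof -
  let ?F = "int_span G S" and ?T = "torsion G 2 B"
  have Sc: "S \<subseteq> carrier G" and Bc: "B \<subseteq> carrier G"
    using int_independent_imp[OF S(1)] subgroup.subset[OF B] by auto
  have F: "subgroup ?F G" and T: "subgroup ?T G" and FB: "?F \<subseteq> B" and TB: "?T \<subseteq> B"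
    using subgroup_int_span[OF Sc] subgroup_torsion[OF B] int_span_subset[OF B S(2)]
    by (auto simp: torsion_def)
  have FT: "subgroup (?F <#> ?T) G"
    by (rule mult_subgroups[OF F T])
  have FTB: "?F <#> ?T \<subseteq> B"
    using FB TB subgroup.m_closed[OF B] unfolding set_mult_def by blast
  note F_FT = set_mult_superset_left[OF F T] and T_FT = set_mult_superset_right[OF F T]
  have "a = \<one>" if a: "a \<in> ?F" "a \<in> ?T" for a
  proof -
    obtain c where c: "a = int_comb G c S" using a by (auto simp: int_span_def)
    have "int_comb G (\<lambda>x. c x * 2) S = \<one>"
      using a(2) int_comb_pow[OF Sc, of c 2] int_pow_int[of G "int_comb G c S" 2]
      by (simp add: torsion_def c)
    then have "c x = 0" if "x \<in> S" for x
      using int_independent_zero[OF S(1), of "\<lambda>x. c x * 2"] that by simp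
    then show ?thesis using c by (simp add: int_comb_zero)
  qed
  then have "?F \<inter> ?T = {\<one>}"
    using subgroup.one_closed[OF F] subgroup.one_closed[OF T] by blast
  then have "subgroup_index G (?F <#> ?T) ?F = card ?T"
    by (rule subgroup_index_prod_eq_card[OF F T])
  then have BF: "subgroup_index G B ?F = subgroup_index G B (?F <#> ?T) * card ?T"
    using subgroup_index_tower[OF F FT B F_FT FTB] by simp
  have "multiples G 2 (?F <#> ?T) = multiples G 2 ?F"
  proof (intro equalityI subsetI)
    fix z assume "z \<in> multiples G 2 (?F <#> ?T)"
    then obtain f t where z: "z = (f \<otimes> t) [^] (2::nat)" "f \<in> ?F" "t \<in> ?T"
      by (auto simp: multiples_def set_mult_def)
    then have "z = f [^] (2::nat)"
    proof -
      have "f \<in> carrier G" "t \<in> carrier G" "t [^] (2::nat) = \<one>"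
        using z FB TB Bc by (auto simp: torsion_def)
      then show ?thesis using z(1) by (simp add: nat_pow_distrib)
    qed
    then show "z \<in> multiples G 2 ?F" using z by (auto simp: multiples_def)
  next
    show "z \<in> multiples G 2 (?F <#> ?T)" if "z \<in> multiples G 2 ?F" for z
      using that F_FT unfolding multiples_eq_image by blast
  qed
  moreover have "subgroup_index G (multiples G 2 B) (multiples G 2 (?F <#> ?T))
      = subgroup_index G B (?F <#> ?T)"
    unfolding multiples_eq_image
    using T_FT by (intro group_hom.subgroup_index_image[OF group_hom_square FT B FTB])
      (auto simp: torsion_def)
  ultimately have 2: "subgroup_index G (multiples G 2 B) (multiples G 2 ?F)
      = subgroup_index G B (?F <#> ?T)"
    by simp
  have F2: "subgroup (multiples G 2 ?F) G" and B2: "subgroup (multiples G 2 B) G"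
    using F B by (auto intro: subgroup_multiples)
  have "multiples G 2 ?F \<subseteq> multiples G 2 B"
    using FB unfolding multiples_eq_image by (rule image_mono)
  from subgroup_index_tower[OF F2 B2 B this multiples_subset[OF B]]
  have "subgroup_index G B (multiples G 2 B) * subgroup_index G B (?F <#> ?T)
      = subgroup_index G B ?F * subgroup_index G ?F (multiples G 2 ?F)"
    using subgroup_index_tower[OF F2 F B multiples_subset[OF F] FB] 2 by simp
  with BF fin show "subgroup_index G B (multiples G 2 B) = 2 ^ card S * card ?T"
    by (simp add: subgroup_index_multiples_int_span[OF S(1)])
  from BF fin show "card ?T \<noteq> 0" by simp
qed

section \<open>Ranks\<close>

text \<open>
  A common exponent \<open>N\<close> carries all generators, hence the whole group, into \<open>H\<close>. So every coset is
  represented by a combination of generators with coefficients in \<open>{0..<N}\<close>.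
\<close>

lemma finite_index_isolator:
  assumes Y: "finite Y" "Y \<subseteq> carrier G" "generate G Y = carrier G"
    and H: "subgroup H G" and iso: "isolator G H = carrier G"
  shows "subgroup_index G (carrier G) H \<noteq> 0"
proof -
  have span: "int_span G Y = carrier G"
    using generate_subset_int_span[OF Y(1,2)] Y(3) subgroup.subset[OF subgroup_int_span[OF Y(2)]]
    by auto
  have "\<forall>x\<in>Y. \<exists>n::int. n \<noteq> 0 \<and> x [^] n \<in> H"
    using Y(2) iso by (auto simp: isolator_def)
  then obtain n :: "'a \<Rightarrow> int" where n: "n x \<noteq> 0" "x [^] n x \<in> H" if "x \<in> Y" for x
    by metis
  define N where "N = \<bar>\<Prod>x\<in>Y. n x\<bar>"
  have "N > 0" using n Y(1) by (auto simp: N_def)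
  have N: "x [^] N \<in> H" if "x \<in> Y" for x
  proof -
    have "n x dvd N" using that Y(1) by (simp add: N_def dvd_prodI)
    then obtain k where "N = n x * k" by auto
    then have "x [^] N = (x [^] n x) [^] k"
      using that Y by (auto simp: int_pow_pow)
    then show ?thesis using n(2)[OF that] subgroup_int_pow_closed[OF H] by simp
  qed
  have comb_N: "int_comb G (\<lambda>x. c x * N) Y \<in> H" for c
  proof -
    have "int_comb G (\<lambda>x. c x * N) Y = int_comb G c Y [^] N"
      using Y by (simp add: int_comb_pow)
    moreover have "int_comb G c Y \<in> {a \<in> carrier G. a [^] N \<in> H}"
    proof (rule int_comb_mem)
      show "subgroup {a \<in> carrier G. a [^] N \<in> H} G"
        using subgroup.one_closed[OF H] subgroup.m_closed[OF H] subgroup.m_inv_closed[OF H]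
        by (intro subgroupI) (auto simp: int_pow_distrib int_pow_inv)
    qed (use N Y in auto)
    ultimately show ?thesis by simp
  qed
  have "(#>) H ` carrier G \<subseteq> (\<lambda>d. H #> int_comb G d Y) ` (\<Pi>\<^sub>E x\<in>Y. {0..<N})"
  proof
    fix M assume "M \<in> (#>) H ` carrier G"
    then obtain c where c: "M = H #> int_comb G c Y"
      unfolding span[symmetric] by (auto simp: int_span_def)
    define d where "d = (\<lambda>x\<in>Y. c x mod N)"
    have "int_comb G (\<lambda>x. c x - d x) Y = int_comb G (\<lambda>x. (c x div N) * N) Y"
      using Y by (intro int_comb_cong) (auto simp: d_def minus_mod_eq_div_mult)
    then have "H #> int_comb G c Y = H #> int_comb G d Y"
      using comb_N[of "\<lambda>x. c x div N"] Y(2) by (simp add: r_coset_eq_iff[OF H] int_comb_diff)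
    moreover have "d \<in> (\<Pi>\<^sub>E x\<in>Y. {0..<N})"
      using \<open>N > 0\<close> by (auto simp: d_def)
    ultimately show "M \<in> (\<lambda>d. H #> int_comb G d Y) ` (\<Pi>\<^sub>E x\<in>Y. {0..<N})"
      unfolding c by (rule image_eqI)
  qed
  then have "finite ((#>) H ` carrier G)"
    by (rule finite_subset) (use Y(1) in \<open>auto intro!: finite_imageI finite_PiE\<close>)
  then show ?thesis
    by (auto simp: subgroup_index_eq_card_cosets)
qed

text \<open>
  A maximal independent set between \<open>S\<close> and the union of \<open>S\<close> with a finite generating set has every
  generator in the isolator of its span.
\<close>

lemma int_independent_extend:
  assumes fg: "finitely_generated_group G" and S: "int_independent G S"
  obtains T where "S \<subseteq> T" "int_independent G T" "isolator G (int_span G T) = carrier G"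
proof -
  obtain Y where Y: "finite Y" "Y \<subseteq> carrier G" "generate G Y = carrier G"
    using fg by (auto simp: finitely_generated_group_def)
  define \<T> where "\<T> = {T. S \<subseteq> T \<and> T \<subseteq> S \<union> Y \<and> int_independent G T}"
  have "\<T> \<subseteq> Pow (S \<union> Y)" by (auto simp: \<T>_def)
  moreover have "finite (Pow (S \<union> Y))"
    using Y(1) int_independent_imp[OF S] by simp
  ultimately have "finite \<T>"
    by (rule finite_subset)
  moreover have "\<T> \<noteq> {}" using S by (auto simp: \<T>_def)
  ultimately have "\<exists>T\<in>\<T>. \<forall>U\<in>\<T>. T \<subseteq> U \<longrightarrow> T = U"
    by (rule finite_has_maximal)
  then obtain T where T\<T>: "T \<in> \<T>" and max: "\<And>U. U \<in> \<T> \<Longrightarrow> T \<subseteq> U \<Longrightarrow> T = U"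
    by blast
  then have T: "S \<subseteq> T" "T \<subseteq> S \<union> Y" "int_independent G T"
    by (simp_all add: \<T>_def)
  let ?I = "isolator G (int_span G T)"
  have Tc: "finite T" "T \<subseteq> carrier G" using int_independent_imp[OF T(3)] by auto
  have sub: "subgroup (int_span G T) G" by (rule subgroup_int_span[OF Tc(2)])
  have "x \<in> ?I" if "x \<in> Y" for x
  proof (rule ccontr)
    assume x: "x \<notin> ?I"
    then have "int_independent G (insert x T)"
      using T(3) Y(2) that by (intro int_independent_insert) auto
    then have "insert x T \<in> \<T>"
      using T that by (auto simp: \<T>_def)
    then have "T = insert x T" by (rule max) blast
    then have "x \<in> T" by blast
    then show False
      using x int_span_superset[OF Tc] isolator_superset[OF sub] by blast
  qed
  then have "carrier G \<subseteq> ?I"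
    unfolding Y(3)[symmetric]
    by (intro generate_subgroup_incl[OF _ subgroup_isolator[OF sub]]) blast
  then have "?I = carrier G" by (auto simp: isolator_def)
  with T show thesis by (intro that) auto
qed

lemma index_multiples_of_isolator:
  assumes fg: "finitely_generated_group G" and S: "int_independent G S"
    and iso: "isolator G (int_span G S) = carrier G"
  shows "subgroup_index G (carrier G) (int_span G S) \<noteq> 0"
    and "subgroup_index G (carrier G) (multiples G 2 (carrier G))
      = 2 ^ card S * card (torsion G 2 (carrier G))"
    and "card (torsion G 2 (carrier G)) \<noteq> 0"
proof -
  have Sc: "S \<subseteq> carrier G" using int_independent_imp[OF S] by auto
  obtain Y where Y: "finite Y" "Y \<subseteq> carrier G" "generate G Y = carrier G"
    using fg by (auto simp: finitely_generated_group_def)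
  show "subgroup_index G (carrier G) (int_span G S) \<noteq> 0"
    by (rule finite_index_isolator[OF Y subgroup_int_span[OF Sc] iso])
  from subgroup_index_multiples[OF subgroup_self S Sc this]
  show "subgroup_index G (carrier G) (multiples G 2 (carrier G))
      = 2 ^ card S * card (torsion G 2 (carrier G))"
    and "card (torsion G 2 (carrier G)) \<noteq> 0" .
qed

text \<open>
  The index of the doubled group does not depend on \<open>S\<close>. This uniform bound turns the supremum in
  the definition of the rank into a maximum.
\<close>

lemma card_int_independent_le:
  assumes fg: "finitely_generated_group G" and S: "int_independent G S"
  shows "card S \<le> subgroup_index G (carrier G) (multiples G 2 (carrier G))"
proof -
  obtain T where T: "S \<subseteq> T" "int_independent G T" "isolator G (int_span G T) = carrier G"
    using int_independent_extend[OF fg S] .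
  have "card S \<le> card T"
    using T int_independent_imp by (auto intro: card_mono)
  also have "\<dots> \<le> 2 ^ card T * card (torsion G 2 (carrier G))"
    using index_multiples_of_isolator(3)[OF fg T(2,3)]
      mult_le_mono[of "card T" "2 ^ card T" 1 "card (torsion G 2 (carrier G))"]
    by (simp add: less_imp_le[OF less_exp])
  finally show ?thesis
    using index_multiples_of_isolator(2)[OF fg T(2,3)] by simp
qed

text \<open>
  An independent set of maximal size in \<open>B\<close> works: an element of \<open>B\<close> outside the isolator could be
  added to it.
\<close>

lemma rank_basis_exists:
  assumes fg: "finitely_generated_group G" and B: "subgroup B G"
  obtains S where "int_independent G S" "S \<subseteq> B" "B \<subseteq> isolator G (int_span G S)"
    "card S = group_rank (G\<lparr>carrier := B\<rparr>)"
proof -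
  let ?\<K> = "{card S | S. int_independent (G\<lparr>carrier := B\<rparr>) S}"
  have K: "?\<K> = {card S | S. int_independent G S \<and> S \<subseteq> B}"
    by (simp add: int_independent_carrier_update[OF B])
  have "?\<K> \<subseteq> {..subgroup_index G (carrier G) (multiples G 2 (carrier G))}"
    using card_int_independent_le[OF fg] by (auto simp: K)
  then have fin: "finite ?\<K>" by (rule finite_subset) simp
  have "int_independent G {}" by (simp add: int_independent_def)
  then have "?\<K> \<noteq> {}" by (auto simp: K)
  then have rank: "group_rank (G\<lparr>carrier := B\<rparr>) = Max ?\<K>"
    using fin by (simp add: group_rank_def cSup_eq_Max)
  also have "\<dots> \<in> ?\<K>" using fin \<open>?\<K> \<noteq> {}\<close> by (rule Max_in)
  finally obtain S where S: "int_independent G S" "S \<subseteq> B"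
    "card S = group_rank (G\<lparr>carrier := B\<rparr>)"
    unfolding K by auto
  have Sc: "finite S" "S \<subseteq> carrier G" using int_independent_imp[OF S(1)] by auto
  have "b \<in> isolator G (int_span G S)" if b: "b \<in> B" for b
  proof (rule ccontr)
    assume nb: "b \<notin> isolator G (int_span G S)"
    then have "int_independent G (insert b S)"
      using S b subgroup.subset[OF B] by (auto intro: int_independent_insert)
    then have "card (insert b S) \<in> ?\<K>"
      unfolding K using S b by auto
    then have "card (insert b S) \<le> card S"
      using Max_ge[OF fin] S(3) rank by simp
    then have "b \<in> S"
      using Sc by (metis card_insert_disjoint not_less_eq_eq order_refl)
    then show False
      using nb int_span_superset[OF Sc] isolator_superset[OF subgroup_int_span[OF Sc(2)]] by auto
  qed
  with S that show thesis by blast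
qed

text \<open>
  Extend \<open>S\<close> to \<open>T\<close> with span of finite index in the whole group. If \<open>b\<close> in \<open>B\<close> is a
  combination of \<open>T\<close>, some nonzero multiple of \<open>b\<close> is a combination of \<open>S\<close>, and independence of
  \<open>T\<close> shows that \<open>b\<close> itself involves only \<open>S\<close>. So \<open>B\<close> meets the span of \<open>T\<close> in the span of \<open>S\<close>,
  and the cosets of the latter in \<open>B\<close> embed into those of the former.
\<close>

lemma finite_index_int_span:
  assumes fg: "finitely_generated_group G" and B: "subgroup B G"
    and S: "int_independent G S" "S \<subseteq> B" and iso: "B \<subseteq> isolator G (int_span G S)"
  shows "subgroup_index G B (int_span G S) \<noteq> 0"
proof -
  obtain T where T: "S \<subseteq> T" "int_independent G T" "isolator G (int_span G T) = carrier G"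
    using int_independent_extend[OF fg S(1)] .
  have fin: "finite T" "T \<subseteq> carrier G" "S \<subseteq> carrier G" "B \<subseteq> carrier G"
    using int_independent_imp[OF T(2)] T(1) subgroup.subset[OF B] by auto
  have sub: "subgroup (int_span G S) G" "subgroup (int_span G T) G"
    using fin by (auto intro: subgroup_int_span)
  have span: "b \<in> int_span G S" if b: "b \<in> B" "b \<in> int_span G T" for b
  proof -
    obtain c where c: "b = int_comb G c T" using b by (auto simp: int_span_def)
    obtain n :: int and d where n: "n \<noteq> 0" "b [^] n = int_comb G d S"
      using b iso by (auto simp: isolator_def int_span_def)
    have "int_comb G (\<lambda>x. c x * n) T = int_comb G (\<lambda>x. if x \<in> S then d x else 0) T"
      using n c T fin by (simp add: int_comb_pow int_comb_restrict)
    then have eq: "c x * n = (if x \<in> S then d x else 0)" if "x \<in> T" for x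
      using int_independent_unique[OF T(2), of "\<lambda>x. c x * n" "\<lambda>x. if x \<in> S then d x else 0"] that
      by simp
    then have "c x = (if x \<in> S then c x else 0)" if "x \<in> T" for x
      using eq[OF that] n(1) by (auto split: if_splits)
    then have "b = int_comb G (\<lambda>x. if x \<in> S then c x else 0) T"
      unfolding c using fin by (intro int_comb_cong) auto
    also have "\<dots> = int_comb G c S"
      using T fin by (simp add: int_comb_restrict)
    finally show ?thesis by (simp add: int_span_def)
  qed
  let ?f = "(#>) (int_span G T)" and ?g = "(#>) (int_span G S)"
  have fg_eq: "?g a = ?g b" if "?f a = ?f b" "a \<in> B" "b \<in> B" for a b
  proof -
    have ab: "a \<in> carrier G" "b \<in> carrier G" using that fin by auto
    have "a \<otimes> inv b \<in> B"
      using that by (intro subgroup.m_closed[OF B] subgroup.m_inv_closed[OF B])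
    moreover have "a \<otimes> inv b \<in> int_span G T"
      using that ab by (simp add: r_coset_eq_iff[OF sub(2)])
    ultimately show ?thesis
      using span ab by (simp add: r_coset_eq_iff[OF sub(1)])
  qed
  have "finite (?f ` carrier G)"
    using index_multiples_of_isolator(1)[OF fg T(2,3)]
    by (simp add: subgroup_index_eq_card_cosets card_eq_0_iff)
  then have "finite (?f ` B)"
    using fin(4) by (meson finite_subset image_mono)
  moreover have "?g ` B \<subseteq> (\<lambda>M. ?g (inv_into B ?f M)) ` ?f ` B"
  proof
    fix M assume "M \<in> ?g ` B"
    then obtain b where b: "b \<in> B" "M = ?g b" by auto
    have "?g (inv_into B ?f (?f b)) = ?g b"
      using b by (intro fg_eq) (auto simp: f_inv_into_f inv_into_into)
    then show "M \<in> (\<lambda>M. ?g (inv_into B ?f M)) ` ?f ` B"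
      using b by (metis imageI)
  qed
  ultimately have "finite (?g ` B)"
    by (meson finite_imageI finite_subset)
  then show ?thesis
    using subgroup.one_closed[OF B] by (auto simp: subgroup_index_eq_card_cosets)
qed

lemma subgroup_index_multiples_rank:
  assumes fg: "finitely_generated_group G" and B: "subgroup B G"
  shows "subgroup_index G B (multiples G 2 B)
      = 2 ^ group_rank (G\<lparr>carrier := B\<rparr>) * card (torsion G 2 B)"
    and "card (torsion G 2 B) \<noteq> 0"
proof -
  obtain S where S: "int_independent G S" "S \<subseteq> B" "B \<subseteq> isolator G (int_span G S)"
    "card S = group_rank (G\<lparr>carrier := B\<rparr>)"
    using rank_basis_exists[OF fg B] .
  from subgroup_index_multiples[OF B S(1,2) finite_index_int_span[OF fg B S(1-3)]] S(4)
  show "subgroup_index G B (multiples G 2 B)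
      = 2 ^ group_rank (G\<lparr>carrier := B\<rparr>) * card (torsion G 2 B)"
    and "card (torsion G 2 B) \<noteq> 0"
    by auto
qed

lemma group_rank_eq_card:
  assumes fg: "finitely_generated_group G" and S: "int_independent G S"
    and iso: "isolator G (int_span G S) = carrier G"
  shows "group_rank G = card S"
proof -
  have "(2::nat) ^ card S = 2 ^ group_rank G"
    using index_multiples_of_isolator[OF fg S iso]
      subgroup_index_multiples_rank[OF fg subgroup_self]
    by simp
  then show ?thesis by simp
qed

lemma isolator_mono: "H \<subseteq> K \<Longrightarrow> isolator G H \<subseteq> isolator G K"
  by (auto simp: isolator_def)

lemma isolator_root:
  assumes "a \<in> carrier G" "n \<noteq> 0" "a [^] (n::int) \<in> isolator G H"
  shows "a \<in> isolator G H"
proof -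
  obtain m :: int where "m \<noteq> 0" "(a [^] n) [^] m \<in> H"
    using assms(3) by (auto simp: isolator_def)
  then show ?thesis
    using assms by (auto simp: isolator_def int_pow_pow intro!: exI[of _ "n * m"])
qed

end

lemma (in comm_monoid) mult_four:
  "a \<in> carrier G \<Longrightarrow> b \<in> carrier G \<Longrightarrow> c \<in> carrier G \<Longrightarrow> d \<in> carrier G \<Longrightarrow>
    (a \<otimes> b) \<otimes> (c \<otimes> d) = (a \<otimes> c) \<otimes> (b \<otimes> d)"
  by (simp add: m_ac)

section \<open>Involutions of abelian groups\<close>

locale comm_group_involution = comm_group +
  fixes s :: "'a \<Rightarrow> 'a"
  assumes s_hom: "s \<in> hom G G" and s_s: "a \<in> carrier G \<Longrightarrow> s (s a) = a"
begin

abbreviation "P \<equiv> plus_part G s"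
abbreviation "M \<equiv> minus_part G s"
abbreviation "N \<equiv> norm_part G s"
abbreviation "D \<equiv> (\<lambda>a. s a \<otimes> inv a) ` carrier G"

sublocale s: group_hom G G s
  using s_hom by (intro group_hom.intro group_hom_axioms.intro is_group)

lemma group_hom_norm: "group_hom G G (\<lambda>a. a \<otimes> s a)"
  by (intro group_hom.intro group_hom_axioms.intro is_group) (auto simp: hom_def m_ac)

lemma group_hom_diff: "group_hom G G (\<lambda>a. s a \<otimes> inv a)"
  by (intro group_hom.intro group_hom_axioms.intro is_group) (auto simp: hom_def m_ac inv_mult)

lemma plus_part_eq_kernel: "P = kernel G G (\<lambda>a. s a \<otimes> inv a)"
proof -
  have "s a = a \<longleftrightarrow> s a \<otimes> inv a = \<one>" if "a \<in> carrier G" for a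
    using that inv_equality[of "s a" "inv a"] by auto
  then show ?thesis
    by (auto simp: plus_part_def kernel_def)
qed

lemma minus_part_eq_kernel: "M = kernel G G (\<lambda>a. a \<otimes> s a)"
proof -
  have "s a = inv a \<longleftrightarrow> a \<otimes> s a = \<one>" if "a \<in> carrier G" for a
    using that inv_equality[of "s a" a] by (auto simp: m_comm[of a])
  then show ?thesis
    by (auto simp: minus_part_def kernel_def)
qed

lemma norm_part_eq_image: "N = (\<lambda>a. a \<otimes> s a) ` carrier G"
  by (auto simp: norm_part_def)

lemma
  shows subgroup_plus_part: "subgroup P G" and subgroup_minus_part: "subgroup M G"
    and subgroup_norm_part: "subgroup N G" and subgroup_diff_part: "subgroup D G"
    and subgroup_plus_minus: "subgroup (P <#> M) G"
proof -
  show "subgroup N G" "subgroup D G"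
    unfolding norm_part_eq_image
    using group_hom.subgroup_img_is_subgroup[OF group_hom_norm subgroup_self]
      group_hom.subgroup_img_is_subgroup[OF group_hom_diff subgroup_self] by auto
  show P: "subgroup P G" and M: "subgroup M G"
    unfolding plus_part_eq_kernel minus_part_eq_kernel
    by (rule group_hom.subgroup_kernel[OF group_hom_diff],
        rule group_hom.subgroup_kernel[OF group_hom_norm])
  show "subgroup (P <#> M) G"
    by (rule mult_subgroups[OF P M])
qed

lemma norm_part_subset: "N \<subseteq> P"
  by (auto simp: norm_part_def plus_part_def s_s m_comm)

lemma diff_part_subset: "D \<subseteq> M"
  by (auto simp: minus_part_def s_s inv_mult m_comm)

text \<open>On \<open>P\<close> the norm is doubling, and it kills \<open>M\<close>.\<close>

lemma norm_image_plus_minus: "(\<lambda>a. a \<otimes> s a) ` (P <#> M) = multiples G 2 P"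
proof -
  have "(p \<otimes> m) \<otimes> s (p \<otimes> m) = p [^] (2::nat)" if "p \<in> P" "m \<in> M" for p m
  proof -
    have pm: "p \<in> carrier G" "s p = p" "m \<in> carrier G" "s m = inv m"
      using that by (auto simp: plus_part_def minus_part_def)
    then have "(p \<otimes> m) \<otimes> s (p \<otimes> m) = (p \<otimes> m) \<otimes> (p \<otimes> inv m)"
      by simp
    also have "\<dots> = (p \<otimes> p) \<otimes> (m \<otimes> inv m)"
      using pm by (intro mult_four) auto
    finally show ?thesis using pm by (simp add: numeral_2_eq_2)
  qed
  note eq = this
  show ?thesis
  proof (intro equalityI subsetI)
    show "x \<in> multiples G 2 P" if "x \<in> (\<lambda>a. a \<otimes> s a) ` (P <#> M)" for x
      using that eq by (auto simp: set_mult_def multiples_def)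
    show "x \<in> (\<lambda>a. a \<otimes> s a) ` (P <#> M)" if "x \<in> multiples G 2 P" for x
    proof -
      obtain p where p: "x = p [^] (2::nat)" "p \<in> P"
        using \<open>x \<in> multiples G 2 P\<close> by (auto simp: multiples_def)
      have "p \<otimes> \<one> \<in> P <#> M"
        using p subgroup.one_closed[OF subgroup_minus_part] unfolding set_mult_def by blast
      moreover have "x = (p \<otimes> \<one>) \<otimes> s (p \<otimes> \<one>)"
        using eq[OF p(2) subgroup.one_closed[OF subgroup_minus_part]] p by simp
      ultimately show ?thesis by (rule rev_image_eqI)
    qed
  qed
qed

text \<open>
  \<open>s - 1\<close> kills \<open>P\<close> and is multiplication by \<open>-2\<close> on \<open>M\<close>.
\<close>

lemma diff_image_plus_minus: "(\<lambda>a. s a \<otimes> inv a) ` (P <#> M) = multiples G 2 M"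
proof -
  have eq: "s (p \<otimes> m) \<otimes> inv (p \<otimes> m) = (inv m) [^] (2::nat)" if "p \<in> P" "m \<in> M" for p m
  proof -
    have pm: "p \<in> carrier G" "s p = p" "m \<in> carrier G" "s m = inv m"
      using that by (auto simp: plus_part_def minus_part_def)
    then have "s (p \<otimes> m) \<otimes> inv (p \<otimes> m) = (p \<otimes> inv m) \<otimes> (inv p \<otimes> inv m)"
      by (simp add: inv_mult)
    also have "\<dots> = (p \<otimes> inv p) \<otimes> (inv m \<otimes> inv m)"
      using pm by (intro mult_four) auto
    finally show ?thesis using pm by (simp add: numeral_2_eq_2)
  qed
  show ?thesis
  proof (intro equalityI subsetI)
    show "x \<in> multiples G 2 M" if "x \<in> (\<lambda>a. s a \<otimes> inv a) ` (P <#> M)" for x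
      using that eq subgroup.m_inv_closed[OF subgroup_minus_part]
      by (auto simp: set_mult_def multiples_def)
    show "x \<in> (\<lambda>a. s a \<otimes> inv a) ` (P <#> M)" if "x \<in> multiples G 2 M" for x
    proof -
      obtain m where m: "x = m [^] (2::nat)" "m \<in> M"
        using \<open>x \<in> multiples G 2 M\<close> by (auto simp: multiples_def)
      have mc: "m \<in> carrier G" using m by (simp add: minus_part_def)
      have m': "inv m \<in> M" by (rule subgroup.m_inv_closed[OF subgroup_minus_part m(2)])
      then have "\<one> \<otimes> inv m \<in> P <#> M"
        using subgroup.one_closed[OF subgroup_plus_part] unfolding set_mult_def by blast
      moreover have "x = s (\<one> \<otimes> inv m) \<otimes> inv (\<one> \<otimes> inv m)"
        using eq[OF subgroup.one_closed[OF subgroup_plus_part] m'] m(1) mc by simp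
      ultimately show ?thesis by (rule rev_image_eqI)
    qed
  qed
qed

lemma index_plus_minus_eq_norm:
  "subgroup_index G (carrier G) (P <#> M) = subgroup_index G N (multiples G 2 P)"
proof -
  have "subgroup_index G ((\<lambda>a. a \<otimes> s a) ` carrier G) ((\<lambda>a. a \<otimes> s a) ` (P <#> M))
      = subgroup_index G (carrier G) (P <#> M)"
  proof (rule group_hom.subgroup_index_image[OF group_hom_norm subgroup_plus_minus subgroup_self])
    show "P <#> M \<subseteq> carrier G" by (rule subgroup.subset[OF subgroup_plus_minus])
    show "b \<in> P <#> M" if "b \<in> carrier G" "b \<otimes> s b = \<one>" for b
      using that set_mult_superset_right[OF subgroup_plus_part subgroup_minus_part]
      by (auto simp: minus_part_eq_kernel kernel_def)
  qed
  then show ?thesis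
    by (simp add: norm_image_plus_minus norm_part_eq_image)
qed

lemma index_plus_minus_eq_diff:
  "subgroup_index G (carrier G) (P <#> M) = subgroup_index G D (multiples G 2 M)"
proof -
  have "subgroup_index G ((\<lambda>a. s a \<otimes> inv a) ` carrier G) ((\<lambda>a. s a \<otimes> inv a) ` (P <#> M))
      = subgroup_index G (carrier G) (P <#> M)"
  proof (rule group_hom.subgroup_index_image[OF group_hom_diff subgroup_plus_minus subgroup_self])
    show "P <#> M \<subseteq> carrier G" by (rule subgroup.subset[OF subgroup_plus_minus])
    show "b \<in> P <#> M" if "b \<in> carrier G" "s b \<otimes> inv b = \<one>" for b
      using that set_mult_superset_left[OF subgroup_plus_part subgroup_minus_part]
      by (auto simp: plus_part_eq_kernel kernel_def)
  qed
  then show ?thesis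
    by (simp add: diff_image_plus_minus)
qed

lemma square_eq_one_iff: "a \<in> carrier G \<Longrightarrow> a [^] (2::nat) = \<one> \<longleftrightarrow> inv a = a"
  using inv_equality[of a a] r_inv[of a] by (fastforce simp: numeral_2_eq_2 simp del: r_inv Units_r_inv)

lemma torsion_minus_eq_plus: "torsion G 2 M = torsion G 2 P"
  by (auto simp: torsion_def plus_part_def minus_part_def square_eq_one_iff)

lemma square_eq_one_if_plus_minus: "a \<in> P \<Longrightarrow> a \<in> M \<Longrightarrow> a [^] (2::nat) = \<one>"
  by (auto simp: plus_part_def minus_part_def square_eq_one_iff)

text \<open>
  \<open>P\<close> and \<open>M\<close> may intersect, but only in elements of order at most two, and such an element
  can be a combination of an independent set only with all coefficients zero.
\<close>

lemma int_independent_plus_minus: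
  assumes S: "int_independent G S" "S \<subseteq> P" and T: "int_independent G T" "T \<subseteq> M"
  shows "int_independent G (S \<union> T)" "S \<inter> T = {}"
proof -
  have fin: "finite S" "finite T" "S \<subseteq> carrier G" "T \<subseteq> carrier G"
    using int_independent_imp[OF S(1)] int_independent_imp[OF T(1)] by auto
  have zero: "c x = 0" if "int_comb G c S \<in> M" "x \<in> S" for c x
  proof -
    let ?p = "int_comb G c S"
    have "?p [^] (2::nat) = \<one>"
      using int_comb_mem[OF subgroup_plus_part S(2)] that by (intro square_eq_one_if_plus_minus)
    then have "int_comb G (\<lambda>x. c x * 2) S = \<one>"
      using int_comb_pow[OF fin(3), of c 2] int_pow_int[of G ?p 2] by simp
    then show ?thesis
      using int_independent_zero[OF S(1), of "\<lambda>x. c x * 2"] that by simp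
  qed
  show disj: "S \<inter> T = {}"
  proof (rule equals0I)
    fix x assume x: "x \<in> S \<inter> T"
    \<comment> \<open>\<open>x\<close> itself is a combination of \<open>S\<close> that lies in \<open>M\<close>, with a nonzero coefficient\<close>
    have "int_comb G (\<lambda>y. if y \<in> {x} then 1 else 0) S = int_comb G (\<lambda>_. 1) {x}"
      using x fin by (intro int_comb_restrict) auto
    also have "\<dots> = x"
    proof -
      have "x \<in> carrier G" using x fin by auto
      then show ?thesis
        using int_comb_insert[of x "{}" "\<lambda>_. 1"] int_comb_zero[of "{}" "\<lambda>_. 1"] by simp
    qed
    finally have "int_comb G (\<lambda>y. if y \<in> {x} then 1 else 0) S \<in> M"
      using x T by auto
    from zero[OF this] x show False by force
  qed
  have "c x = 0" if c: "int_comb G c (S \<union> T) = \<one>" and x: "x \<in> S \<union> T" for c x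
  proof -
    have pm: "int_comb G c S \<otimes> int_comb G c T = \<one>"
      using c fin disj by (simp add: int_comb_Un)
    then have "int_comb G c S = inv (int_comb G c T)"
      using fin by (intro inv_equality[symmetric]) auto
    then have "int_comb G c S \<in> M"
      using int_comb_mem[OF subgroup_minus_part T(2)] subgroup.m_inv_closed[OF subgroup_minus_part]
      by simp
    then have 0: "c y = 0" if "y \<in> S" for y using zero that by blast
    then have "int_comb G c T = \<one>"
      using pm fin by (simp add: int_comb_zero)
    then show ?thesis
      using x 0 int_independent_zero[OF T(1)] by blast
  qed
  then show "int_independent G (S \<union> T)"
    using fin by (simp add: int_independent_def int_comb_def)
qed

text \<open>
  The double of any \<open>a\<close> is \<open>(a + s a) - (s a - a)\<close>, a sum of elements of \<open>P\<close> and \<open>M\<close>. So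
  maximal independent sets of \<open>P\<close> and \<open>M\<close> together generate the group up to torsion.
\<close>

lemma group_rank_plus_minus:
  assumes fg: "finitely_generated_group G"
  shows "group_rank G = group_rank (G\<lparr>carrier := P\<rparr>) + group_rank (G\<lparr>carrier := M\<rparr>)"
proof -
  obtain S where S: "int_independent G S" "S \<subseteq> P" "P \<subseteq> isolator G (int_span G S)"
    "card S = group_rank (G\<lparr>carrier := P\<rparr>)"
    using rank_basis_exists[OF fg subgroup_plus_part] .
  obtain T where T: "int_independent G T" "T \<subseteq> M" "M \<subseteq> isolator G (int_span G T)"
    "card T = group_rank (G\<lparr>carrier := M\<rparr>)"
    using rank_basis_exists[OF fg subgroup_minus_part] .
  note ST = int_independent_plus_minus[OF S(1,2) T(1,2)]
  have fin: "finite (S \<union> T)" "S \<union> T \<subseteq> carrier G"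
    using int_independent_imp[OF ST(1)] by auto
  let ?I = "isolator G (int_span G (S \<union> T))"
  have I: "subgroup ?I G"
    using fin by (intro subgroup_isolator subgroup_int_span)
  have "P \<subseteq> ?I" "M \<subseteq> ?I"
    using S(3) T(3) isolator_mono[OF int_span_mono[OF _ fin]] by blast+
  have "a \<in> ?I" if a: "a \<in> carrier G" for a
  proof -
    have "a \<otimes> s a \<in> N" using a by (auto simp: norm_part_def)
    then have "a \<otimes> s a \<in> ?I"
      using norm_part_subset \<open>P \<subseteq> ?I\<close> by blast
    moreover have "s a \<otimes> inv a \<in> ?I"
      using a diff_part_subset \<open>M \<subseteq> ?I\<close> by blast
    ultimately have "(a \<otimes> s a) \<otimes> inv (s a \<otimes> inv a) \<in> ?I"
      using subgroup.m_closed[OF I] subgroup.m_inv_closed[OF I] by presburger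
    also have "(a \<otimes> s a) \<otimes> inv (s a \<otimes> inv a) = (a \<otimes> s a) \<otimes> (a \<otimes> inv (s a))"
      using a by (simp add: inv_mult m_comm)
    also have "\<dots> = (a \<otimes> a) \<otimes> (s a \<otimes> inv (s a))"
      using a by (intro mult_four) auto
    also have "\<dots> = a [^] (2::int)"
      using a int_pow_int[of G a 2] by (simp add: numeral_2_eq_2)
    finally show ?thesis
      using a by (intro isolator_root[of a 2]) auto
  qed
  then have "?I = carrier G"
    using subgroup.subset[OF I] by blast
  from group_rank_eq_card[OF fg ST(1) this] show ?thesis
    using S(4) T(4) ST(2) fin by (simp add: card_Un_disjoint)
qed

text \<open>
  The towers \<open>2P \<subseteq> N \<subseteq> P\<close> and \<open>2M \<subseteq> D \<subseteq> M\<close>, whose bottom steps both have the index of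
  \<open>P <#> M\<close> in the whole group.
\<close>

lemma index_formulas:
  assumes fg: "finitely_generated_group G"
  shows "2 ^ group_rank (G\<lparr>carrier := P\<rparr>) * card (torsion G 2 P)
      = subgroup_index G P N * subgroup_index G (carrier G) (P <#> M)"
    and "2 ^ group_rank (G\<lparr>carrier := M\<rparr>) * card (torsion G 2 P)
      = subgroup_index G M D * subgroup_index G (carrier G) (P <#> M)"
    and "card (torsion G 2 P) \<noteq> 0"
proof -
  have "multiples G 2 P \<subseteq> N"
    unfolding norm_image_plus_minus[symmetric] norm_part_eq_image
    by (intro image_mono subgroup.subset subgroup_plus_minus)
  from subgroup_index_tower[OF subgroup_multiples[OF subgroup_plus_part] subgroup_norm_part
      subgroup_plus_part this norm_part_subset]
  show "2 ^ group_rank (G\<lparr>carrier := P\<rparr>) * card (torsion G 2 P)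
      = subgroup_index G P N * subgroup_index G (carrier G) (P <#> M)"
    by (simp add: subgroup_index_multiples_rank[OF fg subgroup_plus_part] index_plus_minus_eq_norm)
  have "multiples G 2 M \<subseteq> D"
    unfolding diff_image_plus_minus[symmetric]
    by (intro image_mono subgroup.subset subgroup_plus_minus)
  from subgroup_index_tower[OF subgroup_multiples[OF subgroup_minus_part] subgroup_diff_part
      subgroup_minus_part this diff_part_subset]
  show "2 ^ group_rank (G\<lparr>carrier := M\<rparr>) * card (torsion G 2 P)
      = subgroup_index G M D * subgroup_index G (carrier G) (P <#> M)"
    by (simp add: subgroup_index_multiples_rank[OF fg subgroup_minus_part]
        index_plus_minus_eq_diff torsion_minus_eq_plus)
  show "card (torsion G 2 P) \<noteq> 0"
    by (rule subgroup_index_multiples_rank(2)[OF fg subgroup_plus_part])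
qed

end

section \<open>Cohomology of the group of order two\<close>

lemma card_carrier_FactGroup_subgroup_index:
  "card (carrier (A\<lparr>carrier := B\<rparr> Mod C)) = subgroup_index A B C"
  by (simp add: FactGroup_def subgroup_index_def)

text \<open>
  The cocycle condition at \<open>(1, 1)\<close> forces the value \<open>0\<close> at \<open>1\<close>, and at \<open>(\<sigma>, \<sigma>)\<close> it says that the
  value at \<open>\<sigma>\<close> lies in \<open>A\<^sup>-\<close>. The extension \<open>\<psi> a\<close> of \<open>a\<close> by \<open>0\<close> at \<open>1\<close> is thus an injective
  homomorphism from \<open>A\<close> to the cochains that maps \<open>A\<^sup>-\<close> onto the cocycles and \<open>(\<sigma> - 1)A\<close> onto the
  coboundaries.
\<close>

lemma (in group_module)
  assumes ord: "order G = 2" and \<sigma>: "\<sigma> \<in> carrier G" "generate G {\<sigma>} = carrier G"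
  shows involution_order_two: "comm_group_involution A (\<phi> \<sigma>)"
    and order_group_H1_order_two: "order (group_H1 G A \<phi>)
      = subgroup_index A (minus_part A (\<phi> \<sigma>)) ((\<lambda>a. \<phi> \<sigma> a \<otimes>\<^bsub>A\<^esub> inv\<^bsub>A\<^esub> a) ` carrier A)"
proof -
  note G = order_two_generator[OF G.is_group ord \<sigma>]
  have "\<sigma> \<otimes>\<^bsub>G\<^esub> \<sigma> \<noteq> \<sigma>"
    using \<sigma>(1) G(2) by (metis G.l_cancel_one)
  then have \<sigma>\<sigma>: "\<sigma> \<otimes>\<^bsub>G\<^esub> \<sigma> = \<one>\<^bsub>G\<^esub>"
    using G.m_closed[OF \<sigma>(1) \<sigma>(1)] G(1) by blast
  have auto: "\<phi> \<sigma> \<in> auto A"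
    using hom_closed[OF \<sigma>(1)] by (simp add: AutoGroup_def)
  have "\<phi> \<sigma> (\<phi> \<sigma> a) = a" if "a \<in> carrier A" for a
  proof -
    have "\<phi> (\<sigma> \<otimes>\<^bsub>G\<^esub> \<sigma>) = compose (carrier A) (\<phi> \<sigma>) (\<phi> \<sigma>)"
      using auto hom_mult[OF \<sigma>(1) \<sigma>(1)] by (simp add: AutoGroup_def BijGroup_def auto_def)
    then have "\<phi> \<one>\<^bsub>G\<^esub> a = \<phi> \<sigma> (\<phi> \<sigma> a)"
      using that \<sigma>\<sigma> by (simp add: compose_eq)
    then show ?thesis using action_one[OF that] by simp
  qed
  then show inv: "comm_group_involution A (\<phi> \<sigma>)"
    using auto by unfold_locales (auto simp: auto_def)
  interpret inv: comm_group_involution A "\<phi> \<sigma>" by (rule inv)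
  define \<psi> where "\<psi> a = (\<lambda>g\<in>carrier G. if g = \<sigma> then a else \<one>\<^bsub>A\<^esub>)" for a
  have \<psi>: "\<psi> a \<one>\<^bsub>G\<^esub> = \<one>\<^bsub>A\<^esub>" "\<psi> a \<sigma> = a" for a
    using G \<sigma>(1) by (auto simp: \<psi>_def)
  have \<psi>_eqI: "f = \<psi> a" if "f \<in> extensional (carrier G)" "f \<one>\<^bsub>G\<^esub> = \<one>\<^bsub>A\<^esub>" "f \<sigma> = a" for f a
    using that G by (intro extensionalityI[of f "carrier G"]) (auto simp: \<psi>_def)
  have \<psi>_closed: "\<psi> a \<in> carrier (cochains1 G A)" if "a \<in> carrier A" for a
    using that by (auto simp: \<psi>_def)
  have "group (cochains1 G A)"
    using is_group by (intro product_group)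
  moreover have "\<psi> \<in> hom A (cochains1 G A)"
    using \<psi>_closed by (auto simp: hom_def \<psi>_def intro!: restrict_ext)
  ultimately interpret \<psi>: group_hom A "cochains1 G A" \<psi>
    using is_group by (intro group_hom.intro group_hom_axioms.intro)
  have "cocycles1 G A \<phi> = \<psi> ` inv.M"
  proof (intro equalityI subsetI)
    fix f assume f: "f \<in> cocycles1 G A \<phi>"
    have fc: "f \<one>\<^bsub>G\<^esub> \<in> carrier A" "f \<sigma> \<in> carrier A" "f \<in> extensional (carrier G)"
      using f \<sigma>(1) by (auto simp: cocycles1_def PiE_iff)
    have cocycle: "f (g \<otimes>\<^bsub>G\<^esub> h) = f g \<otimes>\<^bsub>A\<^esub> \<phi> g (f h)" if "g \<in> carrier G" "h \<in> carrier G" for g h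
      using f that by (simp add: cocycles1_def)
    have "f \<one>\<^bsub>G\<^esub> = f \<one>\<^bsub>G\<^esub> \<otimes>\<^bsub>A\<^esub> f \<one>\<^bsub>G\<^esub>"
      using cocycle[of "\<one>\<^bsub>G\<^esub>" "\<one>\<^bsub>G\<^esub>"] action_one[OF fc(1)] by (simp del: hom_one)
    then have f1: "f \<one>\<^bsub>G\<^esub> = \<one>\<^bsub>A\<^esub>"
      using fc(1) by (metis l_cancel_one)
    have "f \<sigma> \<otimes>\<^bsub>A\<^esub> \<phi> \<sigma> (f \<sigma>) = \<one>\<^bsub>A\<^esub>"
      using cocycle[OF \<sigma>(1) \<sigma>(1)] f1 by (simp add: \<sigma>\<sigma>)
    then have "f \<sigma> \<in> inv.M"
      using fc by (simp add: inv.minus_part_eq_kernel kernel_def)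
    then show "f \<in> \<psi> ` inv.M"
      using \<psi>_eqI[OF fc(3) f1] by blast
  next
    fix f assume "f \<in> \<psi> ` inv.M"
    then obtain m where m: "f = \<psi> m" "m \<in> carrier A" "\<phi> \<sigma> m = inv\<^bsub>A\<^esub> m"
      by (auto simp: minus_part_def)
    then show "f \<in> cocycles1 G A \<phi>"
      using \<psi>_closed[OF m(2)] \<psi> \<sigma>(1) by (simp add: cocycles1_def G(1) \<sigma>\<sigma> action_one del: hom_one)
  qed
  moreover have "coboundaries1 G A \<phi> = \<psi> ` inv.D"
  proof -
    have "(\<lambda>g\<in>carrier G. \<phi> g a \<otimes>\<^bsub>A\<^esub> inv\<^bsub>A\<^esub> a) = \<psi> (\<phi> \<sigma> a \<otimes>\<^bsub>A\<^esub> inv\<^bsub>A\<^esub> a)" if "a \<in> carrier A" for a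
      using that \<sigma>(1) by (intro \<psi>_eqI) (simp_all add: action_one del: hom_one)
    then show ?thesis
      unfolding coboundaries1_def Setcompr_eq_image image_image by (intro image_cong) auto
  qed
  moreover have "subgroup_index (cochains1 G A) (\<psi> ` inv.M) (\<psi> ` inv.D)
      = subgroup_index A inv.M inv.D"
  proof (rule \<psi>.subgroup_index_image)
    show "b \<in> inv.D" if "\<psi> b = \<one>\<^bsub>cochains1 G A\<^esub>" for b
    proof -
      have "b = \<one>\<^bsub>A\<^esub>"
        using arg_cong[OF that, of "\<lambda>f. f \<sigma>"] \<psi> \<sigma>(1) by simp
      then show ?thesis using subgroup.one_closed[OF inv.subgroup_diff_part] by simp
    qed
  qed (rule inv.subgroup_diff_part inv.subgroup_minus_part inv.diff_part_subset)+
  ultimately show "order (group_H1 G A \<phi>) = subgroup_index A inv.M inv.D"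
    by (simp add: group_H1_def order_def card_carrier_FactGroup_subgroup_index)
qed

theorem proposition2:
  fixes G :: "('g, 'u) monoid_scheme" and A :: "('a, 'v) monoid_scheme"
    and \<phi> :: "'g \<Rightarrow> 'a \<Rightarrow> 'a" and \<sigma> :: 'g
    and Ap Am NA :: "'a set" and r rp rm :: nat
  assumes "group G" and "order G = 2"
    and "\<sigma> \<in> carrier G" and "generate G {\<sigma>} = carrier G"
    and "group_module G A \<phi>" and "finitely_generated_group A"
  defines "Ap \<equiv> plus_part A (\<phi> \<sigma>)"
    and "Am \<equiv> minus_part A (\<phi> \<sigma>)"
    and "NA \<equiv> norm_part A (\<phi> \<sigma>)"
    and "r \<equiv> group_rank A"
    and "rp \<equiv> group_rank (A\<lparr>carrier := Ap\<rparr>)"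
    and "rm \<equiv> group_rank (A\<lparr>carrier := Am\<rparr>)"
  shows
    "finite (carrier (group_H1 G A \<phi>)) \<and>
     finite (carrier (tate_H0 G A \<phi>)) \<and>
     finite (torsion A 2 Ap) \<and>
     finite (rcosets\<^bsub>A\<^esub> (Ap <#>\<^bsub>A\<^esub> Am)) \<and>
     finite (rcosets\<^bsub>A\<lparr>carrier := NA\<rparr>\<^esub> (multiples A 2 Ap)) \<and>
     finite (rcosets\<^bsub>A\<lparr>carrier := Ap\<rparr>\<^esub> NA) \<and>
     (real (order (group_H1 G A \<phi>)) =
           2 ^ rm * real (card (torsion A 2 Ap))
             / real (subgroup_index A (carrier A) (Ap <#>\<^bsub>A\<^esub> Am)) \<and>
         2 ^ rm * real (card (torsion A 2 Ap))
             / real (subgroup_index A (carrier A) (Ap <#>\<^bsub>A\<^esub> Am)) =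
           2 ^ rm * real (card (torsion A 2 Ap))
             / real (subgroup_index A NA (multiples A 2 Ap)) \<and>
         2 ^ rm * real (card (torsion A 2 Ap))
             / real (subgroup_index A NA (multiples A 2 Ap)) =
           2 powi (int rm - int rp) * real (subgroup_index A Ap NA) \<and>
         2 powi (int rm - int rp) * real (subgroup_index A Ap NA) =
           2 powi (int r - 2 * int rp) * real (subgroup_index A Ap NA)) \<and>
     herbrand_quotient G A \<phi> = 2 powi (2 * int rp - int r) \<and>
     (rp = 0 \<and> torsion A 2 Ap = {\<one>\<^bsub>A\<^esub>} \<longrightarrow>
           carrier A = Ap <#>\<^bsub>A\<^esub> Am \<and>
           order (group_H1 G A \<phi>) = 2 ^ rm \<and> (2::nat) ^ rm = 2 ^ r)"
proof -
  interpret group_module G A \<phi> by fact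
  note gen = assms(2-4)
  interpret inv: comm_group_involution A "\<phi> \<sigma>"
    by (rule involution_order_two[OF gen])
  define i k h t where "i = subgroup_index A (carrier A) (Ap <#>\<^bsub>A\<^esub> Am)"
    and "k = subgroup_index A Ap NA"
    and "h = order (group_H1 G A \<phi>)"
    and "t = card (torsion A 2 Ap)"
  have H0: "order (tate_H0 G A \<phi>) = k"
    unfolding k_def Ap_def NA_def invariants_order_two[OF gen, symmetric]
      norms_order_two[OF gen, symmetric]
    by (simp add: tate_H0_def order_def card_carrier_FactGroup_subgroup_index)
  have i_norm: "subgroup_index A NA (multiples A 2 Ap) = i"
    unfolding i_def Ap_def Am_def NA_def by (rule inv.index_plus_minus_eq_norm[symmetric])
  have plus: "2 ^ rp * t = k * i" and minus: "2 ^ rm * t = h * i" and "t \<noteq> 0"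
    unfolding i_def k_def h_def t_def Ap_def Am_def NA_def rp_def rm_def
      order_group_H1_order_two[OF gen]
    by (rule inv.index_formulas[OF assms(6)])+
  have r: "r = rp + rm"
    unfolding r_def rp_def rm_def Ap_def Am_def by (rule inv.group_rank_plus_minus[OF assms(6)])
  have nz: "i \<noteq> 0" "k \<noteq> 0" "h \<noteq> 0"
    using plus minus \<open>t \<noteq> 0\<close> by (auto intro!: gr0I)
  have "finite (carrier (group_H1 G A \<phi>))" "finite (carrier (tate_H0 G A \<phi>))"
    "finite (torsion A 2 Ap)"
    using nz H0 \<open>t \<noteq> 0\<close> unfolding h_def t_def order_def by (metis card.infinite)+
  moreover have "finite (rcosets\<^bsub>A\<^esub> (Ap <#>\<^bsub>A\<^esub> Am))"
    "finite (rcosets\<^bsub>A\<lparr>carrier := NA\<rparr>\<^esub> (multiples A 2 Ap))"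
    "finite (rcosets\<^bsub>A\<lparr>carrier := Ap\<rparr>\<^esub> NA)"
    using nz i_norm unfolding i_def k_def subgroup_index_def by (auto intro!: card_ge_0_finite)
  moreover
  have plus': "2 ^ rp * real t = real k * real i" and minus': "2 ^ rm * real t = real h * real i"
    using arg_cong[OF plus, of real] arg_cong[OF minus, of real] by simp_all
  have h: "real h = 2 ^ rm * real t / real i"
    using minus' nz by (simp add: field_simps)
  moreover have k: "2 ^ rm * real t / real i = 2 powi (int rm - int rp) * real k"
  proof -
    have "real k = 2 ^ rp * real t / real i"
      using plus' nz by (simp add: field_simps)
    then show ?thesis by (simp add: power_int_diff)
  qed
  moreover have "int r - 2 * int rp = int rm - int rp"
    using r by simp
  moreover have "herbrand_quotient G A \<phi> = 2 powi (2 * int rp - int r)"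
  proof -
    have "herbrand_quotient G A \<phi> = real k / real h"
      by (simp add: herbrand_quotient_def H0 h_def)
    also have "real h = 2 powi (int rm - int rp) * real k"
      using h k by simp
    also have "real k / \<dots> = 2 powi (int rp - int rm)"
      using nz by (simp add: power_int_diff)
    finally show ?thesis using r by simp
  qed
  moreover have "carrier A = Ap <#>\<^bsub>A\<^esub> Am \<and> order (group_H1 G A \<phi>) = 2 ^ rm
      \<and> (2::nat) ^ rm = 2 ^ r" if "rp = 0" "torsion A 2 Ap = {\<one>\<^bsub>A\<^esub>}"
  proof -
    have "t = 1" using that by (simp add: t_def)
    then have "i = 1" using plus that by simp
    have sub: "subgroup (Ap <#>\<^bsub>A\<^esub> Am) A"
      unfolding Ap_def Am_def by (rule inv.subgroup_plus_minus)
    have "a \<in> Ap <#>\<^bsub>A\<^esub> Am" if a: "a \<in> carrier A" for a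
    proof -
      have "card ((#>\<^bsub>A\<^esub>) (Ap <#>\<^bsub>A\<^esub> Am) ` carrier A) = 1"
        using \<open>i = 1\<close> by (simp add: i_def subgroup_index_eq_card_cosets)
      then obtain K where "(#>\<^bsub>A\<^esub>) (Ap <#>\<^bsub>A\<^esub> Am) ` carrier A = {K}"
        by (rule card_1_singletonE)
      then have "Ap <#>\<^bsub>A\<^esub> Am #>\<^bsub>A\<^esub> a = Ap <#>\<^bsub>A\<^esub> Am #>\<^bsub>A\<^esub> \<one>\<^bsub>A\<^esub>"
        using a one_closed by blast
      then show ?thesis
        using a by (simp add: r_coset_eq_iff[OF sub])
    qed
    then have "carrier A = Ap <#>\<^bsub>A\<^esub> Am"
      using subgroup.subset[OF sub] by blast
    moreover have "h = 2 ^ rm"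
      using minus \<open>t = 1\<close> \<open>i = 1\<close> by simp
    ultimately show ?thesis
      using r that by (simp add: h_def)
  qed
  ultimately show ?thesis
    unfolding i_norm i_def[symmetric] k_def[symmetric] h_def[symmetric] t_def[symmetric]
    by simp
qed

end
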